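(* Let $k\ge 2$ and let $S$ be any $k$-family with Laplacian eigenvalues $\lambda_1\ge\lambda_2\ge\cdots$. Then $$\lambda_1+\lambda_2\le (k-1)f_{k-1}(S)+\binom{k+1}{k} = (k-1)f_{k-1}(S)+k+1.$$
   Context: A $k$-family on vertex set $[n]$ is a pure $(k-1)$-dimensional abstract simplicial complex, determined by a nonempty set of $k$-element subsets of $[n]$ (its facets); $f_{k-1}(S)$ is the number of facets. Let $\partial_{k-1}$ be the matrix with rows indexed by the $(k-1)$-element subsets of $[n]$ and columns by the facets, with entry $(-1)^j$ in row $G$, column $F=\{v_0<\cdots<v_{k-1}\}$ if $G=F\setminus\{v_j\}$, and $0$ otherwise. The Laplacian is $L(S)=\partial_{k-1}\partial_{k-1}^T$ with eigenvalues $\lambda_1\ge\lambda_2\ge\cdots\ge0$; set $\lambda_i=0$ beyond the matrix size. *)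

theory Defs
  imports "Jordan_Normal_Form.Char_Poly"
begin

definition abstract_simplicial_complex :: "nat set \<Rightarrow> nat set set \<Rightarrow> bool" where
  "abstract_simplicial_complex V S \<longleftrightarrow>
     S \<noteq> {} \<and> S \<subseteq> Pow V \<and> (\<forall>F\<in>S. \<forall>G. G \<subseteq> F \<longrightarrow> G \<in> S)"

definition facets :: "nat set set \<Rightarrow> nat set set" where
  "facets S = {F \<in> S. \<forall>G\<in>S. F \<subseteq> G \<longrightarrow> G = F}"

(* Not every element of {1..n} needs to be a vertex of S. *)
definition k_family :: "nat \<Rightarrow> nat \<Rightarrow> nat set set \<Rightarrow> bool" where
  "k_family n k S \<longleftrightarrow>
     abstract_simplicial_complex {1..n} S \<and> (\<forall>F\<in>facets S. card F = k)"

(* Matrices are indexed by natural numbers, so the subsets of {1..n} are put into a fixed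
   order; the eigenvalues of the Laplacian do not depend on this choice. *)
definition all_subsets :: "nat \<Rightarrow> nat set list" where
  "all_subsets n = map set (subseqs [1..<Suc n])"

definition row_faces :: "nat \<Rightarrow> nat \<Rightarrow> nat set list" where
  "row_faces n k = filter (\<lambda>G. card G = k - 1) (all_subsets n)"

definition column_faces :: "nat \<Rightarrow> nat set set \<Rightarrow> nat set list" where
  "column_faces n S = filter (\<lambda>F. F \<in> facets S) (all_subsets n)"

definition incidence :: "nat set \<Rightarrow> nat set \<Rightarrow> real" where
  "incidence G F =
     (if \<exists>j < card F. G = F - {sorted_list_of_set F ! j}
      then (-1) ^ (THE j. j < card F \<and> G = F - {sorted_list_of_set F ! j})
      else 0)"

definition boundary_matrix :: "nat \<Rightarrow> nat \<Rightarrow> nat set set \<Rightarrow> real mat" where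
  "boundary_matrix n k S =
     mat (length (row_faces n k)) (length (column_faces n S))
       (\<lambda>(r, c). incidence (row_faces n k ! r) (column_faces n S ! c))"

definition laplacian :: "nat \<Rightarrow> nat \<Rightarrow> nat set set \<Rightarrow> real mat" where
  "laplacian n k S = boundary_matrix n k S * transpose_mat (boundary_matrix n k S)"

(* The Laplacian is real symmetric, so the real roots of its characteristic polynomial,
   counted with multiplicity, are all of its eigenvalues. *)
definition laplacian_spectrum :: "nat \<Rightarrow> nat \<Rightarrow> nat set set \<Rightarrow> real list" where
  "laplacian_spectrum n k S =
     rev (sorted_list_of_multiset (proots (char_poly (laplacian n k S))))"

(* The index i starts at 1. *)
definition laplacian_eigenvalue :: "nat \<Rightarrow> nat \<Rightarrow> nat set set \<Rightarrow> nat \<Rightarrow> real" where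
  "laplacian_eigenvalue n k S i =
     (if 1 \<le> i \<and> i \<le> length (laplacian_spectrum n k S)
      then laplacian_spectrum n k S ! (i - 1) else 0)"

lemma set_all_subsets: "set (all_subsets n) = Pow {1..n}"
  unfolding all_subsets_def set_map subseqs_powset
  by (simp add: atLeastLessThanSuc_atLeastAtMost del: upt_Suc)

lemma distinct_all_subsets: "distinct (all_subsets n)"
  unfolding all_subsets_def by (rule distinct_set_subseqs) simp

lemma set_row_faces: "set (row_faces n k) = {G. G \<subseteq> {1..n} \<and> card G = k - 1}"
  by (auto simp: row_faces_def set_all_subsets)

lemma set_column_faces: "k_family n k S \<Longrightarrow> set (column_faces n S) = facets S"
  unfolding column_faces_def k_family_def abstract_simplicial_complex_def
  by (auto simp: set_all_subsets facets_def)

lemma incidence_eq: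
  assumes "finite F" "j < card F" "G = F - {sorted_list_of_set F ! j}"
  shows "incidence G F = (-1) ^ j"
proof -
  have "i = j" if i: "i < card F" "G = F - {sorted_list_of_set F ! i}" for i
  proof -
    let ?v = "\<lambda>i. sorted_list_of_set F ! i"
    have len: "length (sorted_list_of_set F) = card F" by simp
    have "?v i \<in> F" "?v j \<in> F"
      using assms i nth_mem[of _ "sorted_list_of_set F"] len by (metis set_sorted_list_of_set)+
    hence "?v i = ?v j" using assms(3) i(2) by blast
    thus ?thesis
      using assms i len nth_eq_iff_index_eq[of "sorted_list_of_set F" i j] by simp
  qed
  hence "(THE i. i < card F \<and> G = F - {sorted_list_of_set F ! i}) = j"
    using assms by (intro the_equality) auto
  thus ?thesis using assms(2,3) unfolding incidence_def by auto
qed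

lemma k_family_iff_generated:
  "k_family n k S \<longleftrightarrow>
     facets S \<noteq> {} \<and> (\<forall>F\<in>facets S. F \<subseteq> {1..n} \<and> card F = k) \<and> S = (\<Union>F\<in>facets S. Pow F)"
  (is "_ \<longleftrightarrow> ?R")
proof
  assume K: "k_family n k S"
  hence S: "S \<noteq> {}" "S \<subseteq> Pow {1..n}" "\<And>F G. F \<in> S \<Longrightarrow> G \<subseteq> F \<Longrightarrow> G \<in> S"
    and c: "\<And>F. F \<in> facets S \<Longrightarrow> card F = k"
    by (auto simp: k_family_def abstract_simplicial_complex_def)
  have fin: "finite S" using S(2) finite_subset by blast
  have ex: "\<exists>F\<in>facets S. G \<subseteq> F" if G: "G \<in> S" for G
  proof -
    obtain F where "F \<in> S" "G \<subseteq> F" "\<forall>H\<in>S. F \<subseteq> H \<longrightarrow> F = H"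
      using finite_has_maximal2[OF fin G] by blast
    thus ?thesis unfolding facets_def by blast
  qed
  have sub: "facets S \<subseteq> S" by (auto simp: facets_def)
  have "S = (\<Union>F\<in>facets S. Pow F)"
  proof (intro equalityI subsetI)
    fix G assume "G \<in> S"
    thus "G \<in> (\<Union>F\<in>facets S. Pow F)" using ex by fastforce
  next
    fix G assume "G \<in> (\<Union>F\<in>facets S. Pow F)"
    then obtain F where "F \<in> facets S" "G \<subseteq> F" by auto
    thus "G \<in> S" using sub S(3)[of F G] by auto
  qed
  moreover have "facets S \<noteq> {}" using ex S(1) by fastforce
  moreover have "F \<subseteq> {1..n} \<and> card F = k" if F: "F \<in> facets S" for F
    using c[OF F] sub F S(2) by auto
  ultimately show ?R by auto
next
  assume ?R
  hence ne: "facets S \<noteq> {}" and F: "\<And>F. F \<in> facets S \<Longrightarrow> F \<subseteq> {1..n} \<and> card F = k"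
    and S: "S = (\<Union>F\<in>facets S. Pow F)" by auto
  have mem: "G \<in> S \<longleftrightarrow> (\<exists>F\<in>facets S. G \<subseteq> F)" for G
    by (subst S) auto
  have "S \<noteq> {}" using mem ne by fastforce
  moreover have "S \<subseteq> Pow {1..n}" using mem F by (meson PowI subsetI subset_trans)
  moreover have "\<forall>F\<in>S. \<forall>G. G \<subseteq> F \<longrightarrow> G \<in> S" using mem by (meson subset_trans)
  ultimately show "k_family n k S"
    using F unfolding k_family_def abstract_simplicial_complex_def by simp
qed

end

theory Submission
  imports Defs "Jordan_Normal_Form.Schur_Decomposition" "HOL-Analysis.Convex"
begin

text \<open>
  The nonzero eigenvalues of \<open>L = \<partial> \<partial>\<^sup>T\<close> are those of \<open>\<partial>\<^sup>T \<partial>\<close>, which has diagonal entries \<open>k\<close>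
  and off-diagonal entries in \<open>{-1, 0, 1}\<close>; hence every eigenvalue is at most \<open>k - 1 + f\<close>, which
  suffices for \<open>k \<ge> 3\<close>.

  For \<open>k = 2\<close> the matrix \<open>L\<close> is the Laplacian of a graph with \<open>m\<close> edges. Suppose that
  \<open>\<lambda>\<^sub>1 + \<lambda>\<^sub>2 > m + 3\<close>. Applying Bessel's inequality to the rows of \<open>L - I\<close> and the orthonormal
  system consisting of the two eigenvectors and the constant vector gives
  \<open>(\<lambda>\<^sub>1 - 1)\<^sup>2 + (\<lambda>\<^sub>2 - 1)\<^sup>2 + 1 \<le> \<Sum> (d v - 1)\<^sup>2 + 2 m\<close>, the sum ranging over the \<open>n\<close> non-isolated
  vertices. Deleting a vertex \<open>a\<close> yields \<open>\<lambda>\<^sub>2 \<le> m - d a + 2\<close> and \<open>\<lambda>\<^sub>1 + \<lambda>\<^sub>2 \<le> n + 1 + n\<^sub>a\<close>, where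
  \<open>n\<^sub>a\<close> counts the non-isolated vertices of \<open>G - a\<close>. Let \<open>a\<close> have maximal degree. If
  \<open>2 d a \<le> m\<close>, the left-hand side above exceeds \<open>(m + 1)\<^sup>2 / 2 + 1\<close>; otherwise \<open>\<lambda>\<^sub>1 > d a + 1\<close> and it
  exceeds \<open>(d a)\<^sup>2 + (m - d a + 1)\<^sup>2 + 1\<close>. Counting edges at \<open>a\<close> and at a second vertex \<open>b\<close> shows
  that the right-hand side is smaller than this, except when all edges meet the edge \<open>ab\<close>; then the
  common neighbours of \<open>a\<close> and \<open>b\<close> are twins, both eigenvectors are constant on them, and averaging
  the corresponding rows improves Bessel's inequality by exactly the missing amount.
\<close>

section \<open>Orthogonal eigenvectors of symmetric matrices\<close>

lemma mult_mat_zero_vec: "A \<in> carrier_mat nr nc \<Longrightarrow> A *\<^sub>v 0\<^sub>v nc = (0\<^sub>v nr :: 'a :: semiring_0 vec)"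
  by (intro eq_vecI) auto

text \<open>Deflation, so that a double root is covered as well: in an orthogonal basis starting
  with \<open>v\<close> the matrix becomes block triangular, and its lower block \<open>A3\<close>
  keeps the remaining factor of the characteristic polynomial. An eigenvector of \<open>A3\<close>
  lifts to a vector orthogonal to \<open>v\<close>, and symmetry makes it an eigenvector of
  \<open>A\<close>.\<close>

lemma symmetric_two_orthogonal_eigenvectors:
  fixes A :: "real mat"
  assumes A: "A \<in> carrier_mat n n" and sym: "transpose_mat A = A"
    and dvd: "[:- e, 1:] * [:- f, 1:] dvd char_poly A"
  obtains v w :: "real vec" where "v \<in> carrier_vec n" "w \<in> carrier_vec n" "v \<noteq> 0\<^sub>v n" "w \<noteq> 0\<^sub>v n"
    "A *\<^sub>v v = e \<cdot>\<^sub>v v" "A *\<^sub>v w = f \<cdot>\<^sub>v w" "v \<bullet> w = 0"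
proof -
  obtain g where g: "char_poly A = [:- e, 1:] * [:- f, 1:] * g" using dvd by (elim dvdE)
  have "eigenvalue A e" unfolding eigenvalue_root_char_poly[OF A] g poly_mult by simp
  then obtain v where ev: "eigenvector A v e" unfolding eigenvalue_def by blast
  then have v[simp]: "v \<in> carrier_vec n" and v0: "v \<noteq> 0\<^sub>v n" and Av: "A *\<^sub>v v = e \<cdot>\<^sub>v v"
    using A unfolding eigenvector_def by auto
  have n: "n \<noteq> 0" using v v0 by (metis carrier_vecD eq_vecI index_zero_vec(2) not_less_zero)
  let ?n1 = "n - 1"
  interpret cof_vec_space n "TYPE(real)" .
  define b where "b = basis_completion v"
  define ws where "ws = gram_schmidt n b"
  define W where "W = mat_of_cols n ws"
  define W' where "W' = corthogonal_inv W"
  define A' where "A' = W' * A * W"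
  from basis_completion[OF v v0, folded b_def]
  have dist_b: "distinct b" and indep: "\<not> lin_dep (set b)" and b: "set b \<subseteq> carrier_vec n"
    and hdb: "hd b = v" and len_b: "length b = n" by auto
  from hdb len_b n obtain vs where bv: "b = v # vs" by (cases b) auto
  from gram_schmidt_result[OF b dist_b indep refl, folded ws_def]
  have ws: "set ws \<subseteq> carrier_vec n" "corthogonal ws" "length ws = n" by (auto simp: len_b)
  from gram_schmidt_hd[OF v, of vs, folded bv] have hdws: "hd ws = v" unfolding ws_def .
  have W: "W \<in> carrier_mat n n" using ws mat_of_cols_carrier(1)[of n ws] unfolding W_def by auto
  have W': "W' \<in> carrier_mat n n"
    unfolding W'_def corthogonal_inv_def using W by (auto simp: mat_of_rows_def)
  have orth: "corthogonal_mat W" using orthogonal_mat_of_cols ws unfolding W_def .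
  have W'W: "W' * W = 1\<^sub>m n"
    using corthogonal_inv_result[OF orth] W' unfolding W'_def inverts_mat_def by auto
  have WW': "W * W' = 1\<^sub>m n" by (rule mat_mult_left_right_inverse[OF W' W W'W])
  have A': "A' \<in> carrier_mat n n" using W W' A unfolding A'_def by auto
  have sim: "similar_mat A' A" unfolding similar_mat_def
    by (intro exI, rule similar_mat_witI[of W' W n])
      (insert W W' A A' W'W WW', auto simp: A'_def)
  have col0: "col A' 0 = vec n (\<lambda>i. if i = 0 then e else 0)"
    unfolding A'_def W'_def W_def using corthogonal_col_ev_0[OF A v v0 Av n hdws ws] .
  obtain A1 A2 A0 A3 where split: "split_block A' 1 1 = (A1, A2, A0, A3)"
    by (cases "split_block A' 1 1") auto
  have "dim_row A' = 1 + ?n1" "dim_col A' = 1 + ?n1" using A' n by auto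
  from split_block[OF split this] have A1: "A1 \<in> carrier_mat 1 1" and A2: "A2 \<in> carrier_mat 1 ?n1"
    and A0: "A0 \<in> carrier_mat ?n1 1" and A3: "A3 \<in> carrier_mat ?n1 ?n1"
    and block: "A' = four_block_mat A1 A2 A0 A3" by auto
  have A1id: "A1 = mat 1 1 (\<lambda>_. e)"
    using split[unfolded split_block_def Let_def] arg_cong[OF col0, of "\<lambda>v. v $ 0"] A' n
    by (auto simp: col_def)
  have "A' $$ (Suc i, 0) = 0" if "i < ?n1" for i
    using that arg_cong[OF col0, of "\<lambda>v. v $ Suc i"] A' by auto
  then have A0id: "A0 = 0\<^sub>m ?n1 1"
    using split[unfolded split_block_def Let_def] A' by auto
  have "char_poly A' = char_poly A1 * char_poly A3"
    unfolding block A0id by (rule char_poly_four_block_zeros_col[OF A1 A2 A3])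
  also have "char_poly A1 = [:- e, 1:]"
    by (simp add: A1id char_poly_defs det_def sign_def)
  finally have "[:- e, 1:] * char_poly A3 = [:- e, 1:] * ([:- f, 1:] * g)"
    using char_poly_similar[OF sim] g by (simp only: mult.assoc)
  then have "char_poly A3 = [:- f, 1:] * g"
    by (metis mult_cancel_left pCons_eq_0_iff zero_neq_one)
  then have "eigenvalue A3 f" unfolding eigenvalue_root_char_poly[OF A3] by (simp only: poly_mult) simp
  then obtain z where z: "z \<in> carrier_vec ?n1" "z \<noteq> 0\<^sub>v ?n1" "A3 *\<^sub>v z = f \<cdot>\<^sub>v z"
    using A3 unfolding eigenvalue_def eigenvector_def by auto
  \<comment> \<open>The leading zero keeps \<open>w\<close> in the span of the columns of
    \<open>W\<close> other than \<open>v\<close>.\<close>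
  define z' where "z' = 0\<^sub>v 1 @\<^sub>v z"
  have z': "z' \<in> carrier_vec n" using z n unfolding z'_def by (auto intro!: carrier_vecI)
  have z'0: "z' $ 0 = 0" using z n unfolding z'_def by auto
  have z'n: "z' \<noteq> 0\<^sub>v n"
  proof
    assume eq: "z' = 0\<^sub>v n"
    have "z = 0\<^sub>v ?n1"
    proof (rule eq_vecI)
      fix i assume "i < dim_vec (0\<^sub>v ?n1 :: real vec)"
      then show "z $ i = 0\<^sub>v ?n1 $ i"
        using arg_cong[OF eq, of "\<lambda>v. v $ Suc i"] z n by (auto simp: z'_def)
    qed (use z in auto)
    with z show False by simp
  qed
  define w where "w = W *\<^sub>v z'"
  have w: "w \<in> carrier_vec n" using W z' unfolding w_def by auto
  have W'w: "W' *\<^sub>v w = z'"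
    unfolding w_def using W W' z' W'W by (simp flip: assoc_mult_mat_vec)
  have w0: "w \<noteq> 0\<^sub>v n" using W'w z'n W' by (metis mult_mat_zero_vec)
  have W0: "col W 0 = v"
    using hdws ws n v unfolding W_def by (metis col_mat_of_cols hd_conv_nth length_0_conv not_gr0)
  have vw: "v \<bullet> w = 0"
  proof -
    have "v \<bullet> w = (transpose_mat W *\<^sub>v v) \<bullet> z'"
      unfolding w_def using transpose_vec_mult_scalar[OF W z' v] by simp
    also have "\<dots> = (\<Sum>i<n. (transpose_mat W *\<^sub>v v) $ i * z' $ i)"
      using z' by (simp add: scalar_prod_def lessThan_atLeast0)
    also have "\<dots> = 0"
    proof (rule sum.neutral, safe)
      fix i assume i: "i < n"
      show "(transpose_mat W *\<^sub>v v) $ i * z' $ i = 0"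
      proof (cases "i = 0")
        case False
        have "col W i \<bullet> col W 0 = 0"
          using corthogonal_matD[OF orth, of i 0] False i n W by auto
        then show ?thesis using i W W0 by auto
      qed (simp add: z'0)
    qed
    finally show ?thesis .
  qed
  have "A *\<^sub>v w = (W * W') *\<^sub>v (A *\<^sub>v w)" using A w unfolding WW' by simp
  also have "\<dots> = W *\<^sub>v (A' *\<^sub>v z')"
    unfolding A'_def w_def using W W' A z' by (simp add: assoc_mult_mat_vec[of _ n n _ n])
  also have "A' *\<^sub>v z' = (A2 *\<^sub>v z) @\<^sub>v (f \<cdot>\<^sub>v z)"
    unfolding block z'_def
    by (subst four_block_mat_mult_vec[OF A1 A2 A0 A3])
      (use z A1 A2 A3 in \<open>auto simp: A0id mult_mat_zero_vec[of _ _ 1, simplified] mult_mat_zero_vec[OF A1, simplified]\<close>)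
  also have "\<dots> = ((A2 *\<^sub>v z) $ 0) \<cdot>\<^sub>v unit_vec n 0 + f \<cdot>\<^sub>v z'"
    by (rule eq_vecI) (use z A2 n in \<open>auto simp: z'_def unit_vec_def\<close>)
  also have "W *\<^sub>v \<dots> = ((A2 *\<^sub>v z) $ 0) \<cdot>\<^sub>v v + f \<cdot>\<^sub>v w"
  proof -
    have "W *\<^sub>v unit_vec n 0 = v"
      unfolding W0[symmetric] by (intro eq_vecI) (use W n in auto)
    then show ?thesis
      using W z' unfolding w_def
      by (simp add: mult_add_distrib_mat_vec[of _ n n] mult_mat_vec[of _ n n])
  qed
  finally have Aw: "A *\<^sub>v w = ((A2 *\<^sub>v z) $ 0) \<cdot>\<^sub>v v + f \<cdot>\<^sub>v w" .
  \<comment> \<open>Symmetry moves \<open>A\<close> onto the eigenvector \<open>v\<close>, which is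
    orthogonal to \<open>w\<close>; so \<open>A *\<^sub>v w\<close> has no component along
    \<open>v\<close>.\<close>
  have "v \<bullet> (A *\<^sub>v w) = (A *\<^sub>v v) \<bullet> w"
    using transpose_vec_mult_scalar[OF A w v] sym by simp
  then have "(A2 *\<^sub>v z) $ 0 * (v \<bullet> v) = 0"
    using v w vw unfolding Aw Av by (simp add: scalar_prod_add_distrib[of _ n])
  moreover have "v \<bullet> v \<noteq> 0" using v v0 conjugate_square_eq_0_vec[OF v] by simp
  ultimately have "(A2 *\<^sub>v z) $ 0 = 0" by simp
  then have "A *\<^sub>v w = f \<cdot>\<^sub>v w" using Aw v w by (auto intro!: eq_vecI)
  then show thesis using that[OF v w v0 w0 Av _ vw] by blast
qed

section \<open>Laplacian forms of finite graphs\<close>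

text \<open>Indicator sums stay in product form over the whole of \<open>V\<close>, ready to be
  swapped, split at a vertex and distributed.\<close>

declare sum_of_bool_mult_eq [simp del] sum_mult_of_bool_eq [simp del]
  sum_of_bool_eq [simp del]

lemma of_bool_power2 [simp]: "(of_bool p)\<^sup>2 = (of_bool p :: 'a :: semiring_1)"
  by (cases p) auto


locale fin_graph =
  fixes V :: "'a set" and adj :: "'a \<Rightarrow> 'a \<Rightarrow> bool"
  assumes finite_V [simp]: "finite V"
    and adj_sym: "adj u v \<Longrightarrow> adj v u"
    and adj_irrefl [simp]: "\<not> adj v v"
    and adj_in_V: "adj u v \<Longrightarrow> u \<in> V"
begin

section \<open>Degrees and edge counts\<close>

definition deg :: "'a \<Rightarrow> nat" where
  "deg v = card {u \<in> V. adj v u}"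

lemma adj_commute: "adj u v = adj v u"
  using adj_sym by blast

lemma deg_eq_sum: "of_nat (deg v) = (\<Sum>u\<in>V. of_bool (adj v u) :: 'b :: semiring_1)"
  unfolding deg_def by (simp add: sum.If_cases of_bool_def Int_def)

text \<open>Only the edge \<open>vw\<close> is counted at both ends. Edges enter through the degree
  sum alone, so those leaving \<open>{v, w}\<close> are charged to the degrees of the other
  vertices.\<close>

lemma deg_add_le:
  assumes m: "(\<Sum>v\<in>V. deg v) = 2 * m" and vw: "adj v w"
  shows "deg v + deg w \<le> m + 1"
proof -
  have V: "v \<in> V" "w \<in> V" "v \<noteq> w" using vw adj_in_V adj_sym adj_irrefl by blast+
  have split: "sum f V = f v + f w + sum f (V - {v, w})" for f :: "'a \<Rightarrow> nat"
    using V by (simp add: sum.remove[of V v] sum.remove[of "V - {v}" w] Diff_insert2[symmetric] insert_commute)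
  have "of_bool (adj x v) + of_bool (adj x w) \<le> deg x" if "x \<in> V - {v, w}" for x
  proof -
    have "deg x = of_bool (adj x v) + of_bool (adj x w) + (\<Sum>u\<in>V - {v, w}. of_bool (adj x u))"
      using deg_eq_sum[of x, where 'b = nat] split[of "\<lambda>u. of_bool (adj x u)"] by simp
    then show ?thesis by simp
  qed
  then have "(\<Sum>x\<in>V - {v, w}. of_bool (adj x v) + of_bool (adj x w)) \<le> (\<Sum>x\<in>V - {v, w}. deg x)"
    by (rule sum_mono)
  moreover have "(\<Sum>x\<in>V - {v, w}. of_bool (adj x v)) + 1 = deg v"
    using deg_eq_sum[of v, where 'b = nat] split[of "\<lambda>u. of_bool (adj v u)"] vw
    by (simp add: adj_commute[of v])
  moreover have "(\<Sum>x\<in>V - {v, w}. of_bool (adj x w)) + 1 = deg w"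
    using deg_eq_sum[of w, where 'b = nat] split[of "\<lambda>u. of_bool (adj w u)"] vw
    by (simp add: adj_commute[of w])
  ultimately show ?thesis using m split[of deg] by (simp add: sum.distrib)
qed

text \<open>Symmetrization: it brings in \<open>deg u + deg v\<close>, which
  \<open>deg_add_le\<close> bounds on every edge.\<close>

lemma sum_deg_weighted:
  fixes f :: "'a \<Rightarrow> 'a \<Rightarrow> 'b :: comm_ring_1"
  assumes "\<And>u v. f u v = f v u"
  shows "2 * (\<Sum>u\<in>V. \<Sum>v\<in>V. of_nat (deg u) * f u v)
    = (\<Sum>u\<in>V. \<Sum>v\<in>V. of_nat (deg u + deg v) * f u v)"
proof -
  have "(\<Sum>u\<in>V. \<Sum>v\<in>V. of_nat (deg u) * f u v) = (\<Sum>u\<in>V. \<Sum>v\<in>V. of_nat (deg v) * f u v)"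
    by (subst sum.swap) (simp add: assms)
  then show ?thesis by (simp add: sum.distrib algebra_simps)
qed

lemma sum_deg_sq_le:
  assumes m: "(\<Sum>v\<in>V. deg v) = 2 * m"
  shows "(\<Sum>v\<in>V. (int (deg v))\<^sup>2) \<le> (int m)\<^sup>2 + int m"
proof -
  have "(\<Sum>v\<in>V. (int (deg v))\<^sup>2) = (\<Sum>u\<in>V. \<Sum>v\<in>V. of_nat (deg u) * of_bool (adj u v))"
    by (simp add: power2_eq_square deg_eq_sum sum_distrib_left)
  then have "2 * (\<Sum>v\<in>V. (int (deg v))\<^sup>2)
      = (\<Sum>u\<in>V. \<Sum>v\<in>V. of_nat (deg u + deg v) * of_bool (adj u v))"
    using sum_deg_weighted[of "\<lambda>u v. of_bool (adj u v) :: int"] by (simp add: adj_commute)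
  also have "\<dots> \<le> (\<Sum>u\<in>V. \<Sum>v\<in>V. (int m + 1) * of_bool (adj u v))"
    using deg_add_le[OF m] by (intro sum_mono) (force simp: of_bool_def)
  also have "\<dots> = (int m + 1) * (\<Sum>v\<in>V. int (deg v))"
    by (simp add: deg_eq_sum flip: sum_distrib_left)
  also have "(\<Sum>v\<in>V. int (deg v)) = 2 * int m"
    using m by (metis of_nat_mult of_nat_numeral of_nat_sum)
  finally show ?thesis by (simp add: power2_eq_square algebra_simps)
qed

section \<open>The graph Laplacian and its quadratic form\<close>

definition qform :: "('a \<Rightarrow> real) \<Rightarrow> real" where
  "qform y = (\<Sum>u\<in>V. \<Sum>v\<in>V. of_bool (adj u v) * (y u - y v)\<^sup>2) / 2"

definition lap :: "('a \<Rightarrow> real) \<Rightarrow> 'a \<Rightarrow> real" where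
  "lap y v = (\<Sum>u\<in>V. of_bool (adj v u) * (y v - y u))"

lemma lap_eq: "lap y v = real (deg v) * y v - (\<Sum>u\<in>V. of_bool (adj v u) * y u)"
  by (simp add: lap_def deg_eq_sum sum_distrib_right sum_subtractf right_diff_distrib)

lemma lap_linear: "lap (\<lambda>v. s * x v + t * y v) v = s * lap x v + t * lap y v"
  by (simp add: lap_def sum_distrib_left algebra_simps flip: sum.distrib sum_subtractf)

lemma qform_nonneg: "0 \<le> qform y"
  unfolding qform_def by (simp add: sum_nonneg)

text \<open>Summation by parts. The double sum visits each edge in both directions, which accounts
  for the division by 2 in \<open>qform\<close>.\<close>

lemma sum_mult_lap: "(\<Sum>v\<in>V. y v * lap y v) = qform y"
proof -
  let ?S = "\<Sum>u\<in>V. \<Sum>v\<in>V. of_bool (adj u v) * (y u * (y u - y v))"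
  let ?T = "\<Sum>u\<in>V. \<Sum>v\<in>V. of_bool (adj u v) * (y v * (y v - y u))"
  have "?S = ?T" by (subst sum.swap) (simp add: adj_commute)
  moreover have "?S + ?T = (\<Sum>u\<in>V. \<Sum>v\<in>V. of_bool (adj u v) * (y u - y v)\<^sup>2)"
    unfolding sum.distrib[symmetric]
    by (intro sum.cong refl) (simp add: power2_eq_square algebra_simps)
  ultimately have "2 * ?S = (\<Sum>u\<in>V. \<Sum>v\<in>V. of_bool (adj u v) * (y u - y v)\<^sup>2)"
    by simp
  then show ?thesis
    by (simp add: qform_def lap_def sum_distrib_left mult_ac)
qed

text \<open>The two directions of an edge cancel. This makes eigenvectors for nonzero eigenvalues
  orthogonal to the constant vector.\<close>

lemma sum_lap: "(\<Sum>v\<in>V. lap y v) = 0"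
proof -
  let ?S = "\<Sum>u\<in>V. \<Sum>v\<in>V. of_bool (adj u v) * (y u - y v)"
  have "?S = (\<Sum>u\<in>V. \<Sum>v\<in>V. of_bool (adj u v) * (y v - y u))"
    by (subst sum.swap) (simp add: adj_commute)
  also have "\<dots> = - ?S" by (simp add: algebra_simps flip: sum_negf)
  finally show ?thesis by (simp add: lap_def)
qed

text \<open>The bound of the largest eigenvalue by the maximum of \<open>deg u + deg v\<close> over
  edges: Cauchy-Schwarz in each row and symmetrization bound the squared norm of
  \<open>lap y\<close> by \<open>(m + 1) * qform y\<close>; Cauchy-Schwarz for \<open>y\<close> and
  \<open>lap y\<close> then leaves one factor \<open>qform y\<close> to cancel.\<close>

lemma qform_le_edges:
  assumes m: "(\<Sum>v\<in>V. deg v) = 2 * m"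
  shows "qform y \<le> (real m + 1) * (\<Sum>v\<in>V. (y v)\<^sup>2)"
proof -
  let ?z = "\<lambda>u v. of_bool (adj u v) * (y u - y v)\<^sup>2"
  have "(lap y u)\<^sup>2 \<le> real (deg u) * (\<Sum>v\<in>V. ?z u v)" for u
  proof -
    have "(lap y u)\<^sup>2 = (\<Sum>v\<in>V. of_bool (adj u v) * (of_bool (adj u v) * (y u - y v)))\<^sup>2"
      unfolding lap_def by (intro arg_cong[where f = "\<lambda>s. s\<^sup>2"] sum.cong) auto
    also have "\<dots> \<le> (\<Sum>v\<in>V. (of_bool (adj u v))\<^sup>2) * (\<Sum>v\<in>V. (of_bool (adj u v) * (y u - y v))\<^sup>2)"
      by (rule Cauchy_Schwarz_ineq_sum)
    finally show ?thesis by (simp add: deg_eq_sum power_mult_distrib)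
  qed
  then have "2 * (\<Sum>u\<in>V. (lap y u)\<^sup>2) \<le> 2 * (\<Sum>u\<in>V. real (deg u) * (\<Sum>v\<in>V. ?z u v))"
    by (simp add: sum_mono)
  also have "\<dots> = (\<Sum>u\<in>V. \<Sum>v\<in>V. of_nat (deg u + deg v) * ?z u v)"
    using sum_deg_weighted[of ?z] by (simp add: adj_commute power2_commute sum_distrib_left)
  also have "\<dots> \<le> (\<Sum>u\<in>V. \<Sum>v\<in>V. (real m + 1) * ?z u v)"
  proof (intro sum_mono)
    fix u v
    show "of_nat (deg u + deg v) * ?z u v \<le> (real m + 1) * ?z u v"
    proof (cases "adj u v")
      case True
      then have "real (deg u + deg v) \<le> real m + 1" using deg_add_le[OF m True] by linarith
      then show ?thesis by (intro mult_right_mono) auto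
    qed simp
  qed
  also have "\<dots> = 2 * (real m + 1) * qform y"
    by (simp add: qform_def flip: sum_distrib_left)
  finally have L: "(\<Sum>u\<in>V. (lap y u)\<^sup>2) \<le> (real m + 1) * qform y"
    by (simp add: algebra_simps)
  have "(qform y)\<^sup>2 \<le> (\<Sum>v\<in>V. (y v)\<^sup>2) * (\<Sum>v\<in>V. (lap y v)\<^sup>2)"
    unfolding sum_mult_lap[symmetric] by (rule Cauchy_Schwarz_ineq_sum)
  also have "\<dots> \<le> (\<Sum>v\<in>V. (y v)\<^sup>2) * ((real m + 1) * qform y)"
    using L by (intro mult_left_mono) (auto simp: sum_nonneg)
  finally have "qform y * qform y \<le> ((real m + 1) * (\<Sum>v\<in>V. (y v)\<^sup>2)) * qform y"
    by (simp add: power2_eq_square mult_ac)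
  then show ?thesis using qform_nonneg[of y]
    by (cases "qform y = 0") (auto simp: sum_nonneg mult_le_cancel_right)
qed

text \<open>Comparison with the complete graph on the \<open>N\<close> non-isolated vertices, whose
  form is \<open>N\<close> times the sum of squares minus the square of the sum.\<close>

lemma qform_le_vertices:
  "qform y \<le> real (card {v \<in> V. 0 < deg v}) * (\<Sum>v\<in>V. (y v)\<^sup>2)"
proof -
  let ?U = "{v \<in> V. 0 < deg v}"
  have U: "adj u v \<Longrightarrow> u \<in> ?U \<and> v \<in> ?U" for u v
    unfolding deg_def using adj_in_V[of u v] adj_in_V[of v u] adj_sym[of u v]
    by (auto simp: card_gt_0_iff)
  have "2 * qform y = (\<Sum>u\<in>?U. \<Sum>v\<in>?U. of_bool (adj u v) * (y u - y v)\<^sup>2)"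
  proof -
    have "2 * qform y = (\<Sum>u\<in>?U. \<Sum>v\<in>V. of_bool (adj u v) * (y u - y v)\<^sup>2)"
      unfolding qform_def using U by simp (rule sum.mono_neutral_right; force intro!: sum.neutral)
    also have "\<dots> = (\<Sum>u\<in>?U. \<Sum>v\<in>?U. of_bool (adj u v) * (y u - y v)\<^sup>2)"
      using U by (intro sum.cong refl sum.mono_neutral_right) fastforce+
    finally show ?thesis .
  qed
  also have "\<dots> \<le> (\<Sum>u\<in>?U. \<Sum>v\<in>?U. (y u - y v)\<^sup>2)"
    by (intro sum_mono) (auto simp: of_bool_def)
  also have "\<dots> = 2 * (real (card ?U) * (\<Sum>v\<in>?U. (y v)\<^sup>2) - (\<Sum>v\<in>?U. y v)\<^sup>2)"
    by (simp add: power2_diff sum.distrib sum_subtractf power2_eq_square sum_product algebra_simps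
        sum_distrib_left sum_distrib_right)
  also have "\<dots> \<le> 2 * (real (card ?U) * (\<Sum>v\<in>V. (y v)\<^sup>2))"
  proof -
    have "(\<Sum>v\<in>?U. (y v)\<^sup>2) \<le> (\<Sum>v\<in>V. (y v)\<^sup>2)" by (intro sum_mono2) auto
    then have "real (card ?U) * (\<Sum>v\<in>?U. (y v)\<^sup>2) \<le> real (card ?U) * (\<Sum>v\<in>V. (y v)\<^sup>2)"
      by (intro mult_left_mono) auto
    then show ?thesis by (smt (verit) zero_le_power2)
  qed
  finally show ?thesis by simp
qed

end

section \<open>Degree counting around two vertices\<close>

lemma sum_remove2:
  fixes f :: "'a \<Rightarrow> 'b :: comm_monoid_add"
  assumes "finite V" "a \<in> V" "b \<in> V" "a \<noteq> b"
  shows "sum f V = f a + (f b + sum f (V - {a, b}))"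
proof -
  have "V - {a} - {b} = V - {a, b}" by auto
  then show ?thesis using assms by (simp add: sum.remove[of V a] sum.remove[of "V - {a}" b])
qed

context fin_graph
begin

lemma fin_graph_restrict: "fin_graph W (\<lambda>u v. adj u v \<and> u \<in> W \<and> v \<in> W)" if "W \<subseteq> V"
  using that finite_subset[OF that finite_V] adj_sym by unfold_locales auto

text \<open>Here \<open>r v\<close> is the number of neighbours of \<open>v\<close> in \<open>W\<close>, and \<open>eW\<close> the number of edges
  inside \<open>W\<close>.\<close>

context
  fixes a b :: 'a and m :: nat
  assumes ab: "a \<in> V" "b \<in> V" "a \<noteq> b" and m: "(\<Sum>v\<in>V. deg v) = 2 * m"
begin

abbreviation "W \<equiv> V - {a, b}"
abbreviation "\<alpha> v \<equiv> of_bool (adj a v) :: int"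
abbreviation "\<beta> v \<equiv> of_bool (adj b v) :: int"
abbreviation "\<delta> \<equiv> of_bool (adj a b) :: int"
abbreviation "r v \<equiv> int (deg v) - \<alpha> v - \<beta> v"

definition eW :: int where
  "eW = int m - int (deg a) - int (deg b) + \<delta>"

lemma r_eq: "r v = (\<Sum>w\<in>W. of_bool (adj v w))"
  using sum_remove2[OF finite_V ab, of "\<lambda>w. of_bool (adj v w) :: int"]
  by (simp add: deg_eq_sum adj_commute)

lemma r_nonneg: "0 \<le> r v"
  unfolding r_eq by (simp add: sum_nonneg)

lemma sum_alpha: "(\<Sum>v\<in>W. \<alpha> v) = int (deg a) - \<delta>"
  using sum_remove2[OF finite_V ab, of \<alpha>] by (simp add: deg_eq_sum)

lemma sum_beta: "(\<Sum>v\<in>W. \<beta> v) = int (deg b) - \<delta>"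
  using sum_remove2[OF finite_V ab, of \<beta>] by (simp add: deg_eq_sum adj_commute[of b a])

lemma sum_r: "(\<Sum>v\<in>W. r v) = 2 * eW"
proof -
  have "int (\<Sum>v\<in>V. deg v) = 2 * int m" using m by simp
  then have "int (deg a) + int (deg b) + (\<Sum>v\<in>W. int (deg v)) = 2 * int m"
    using sum_remove2[OF finite_V ab, of "\<lambda>v. int (deg v)"] by simp
  then show ?thesis
    using sum_alpha sum_beta by (simp add: sum_subtractf eW_def)
qed

lemma eW_nonneg: "0 \<le> eW"
  using sum_r sum_nonneg[of W r] r_nonneg by simp

lemma sum_r_sq: "(\<Sum>v\<in>W. (r v)\<^sup>2) \<le> eW\<^sup>2 + eW"
proof -
  interpret R: fin_graph W "\<lambda>u v. adj u v \<and> u \<in> W \<and> v \<in> W"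
    by (rule fin_graph_restrict) auto
  have R: "int (R.deg v) = r v" if "v \<in> W" for v
    unfolding R.deg_eq_sum r_eq using that by (intro sum.cong) auto
  have "int (\<Sum>v\<in>W. R.deg v) = 2 * eW" using sum_r R by simp
  then have "int (\<Sum>v\<in>W. R.deg v) = int (2 * nat eW)" using eW_nonneg by (simp del: of_nat_sum)
  then have "(\<Sum>v\<in>W. R.deg v) = 2 * nat eW" by (simp only: of_nat_eq_iff)
  from R.sum_deg_sq_le[OF this] show ?thesis using R eW_nonneg by simp
qed

lemma card_V: "int (card V) = 2 + int (card W)"
  using ab card_Diff_subset[of "{a, b}" V] card_mono[of V "{a, b}"] by (simp add: of_nat_diff)

text \<open>The condition on \<open>v\<close> says that it has a neighbour besides \<open>a\<close>.
  For \<open>v\<close> in \<open>W\<close> this means being adjacent to \<open>b\<close> or having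
  \<open>r v \<ge> 1\<close>, and \<open>\<beta> v + r v - \<beta> v * r v\<close> dominates the
  indicator of that; \<open>b\<close> itself adds at most 1.\<close>

lemma card_nonisolated_le:
  "int (card {v \<in> V - {a}. of_bool (adj a v) < deg v})
     \<le> 1 + (int (deg b) - \<delta>) + 2 * eW - (\<Sum>v\<in>W. \<beta> v * r v)"
proof -
  let ?f = "\<lambda>v. of_bool (of_bool (adj a v) < deg v) :: int"
  have 1: "int (card {v \<in> V - {a}. of_bool (adj a v) < deg v}) = (\<Sum>v\<in>V - {a}. ?f v)"
    by (simp add: sum_of_bool_eq Int_def)
  have "V - {a} - {b} = W" by auto
  then have 2: "(\<Sum>v\<in>V - {a}. ?f v) = ?f b + (\<Sum>v\<in>W. ?f v)"
    using ab by (subst sum.remove[of _ b]) auto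
  have 3: "?f v \<le> \<beta> v + r v - \<beta> v * r v" for v
    using r_nonneg[of v] by (cases "adj a v"; cases "adj b v") (auto simp: of_bool_def)
  have 4: "(\<Sum>v\<in>W. ?f v) \<le> (\<Sum>v\<in>W. \<beta> v + r v - \<beta> v * r v)"
    by (rule sum_mono) (rule 3)
  have 5: "(\<Sum>v\<in>W. \<beta> v + r v - \<beta> v * r v)
      = (int (deg b) - \<delta>) + 2 * eW - (\<Sum>v\<in>W. \<beta> v * r v)"
    by (simp only: sum_subtractf[of "\<lambda>v. \<beta> v + r v"] sum.distrib[of \<beta> r] sum_beta sum_r)
  have "?f b \<le> 1" by simp
  with 1 2 4 5 show ?thesis by linarith
qed

lemma sum_deg_minus_one_sq_split:
  "(\<Sum>v\<in>V. (int (deg v) - 1)\<^sup>2)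
     = (int (deg a) - 1)\<^sup>2 + (int (deg b) - 1)\<^sup>2 + (\<Sum>v\<in>W. (\<alpha> v + \<beta> v + r v - 1)\<^sup>2)"
  using sum_remove2[OF finite_V ab, of "\<lambda>v. (int (deg v) - 1)\<^sup>2"] by simp

lemma sum_beta_r_le: "(\<Sum>v\<in>W. \<beta> v * r v) \<le> 2 * eW"
proof -
  have "\<beta> v * r v \<le> r v" for v using r_nonneg[of v] by (cases "adj b v") auto
  then have "(\<Sum>v\<in>W. \<beta> v * r v) \<le> (\<Sum>v\<in>W. r v)" by (intro sum_mono)
  then show ?thesis by (simp only: sum_r)
qed

text \<open>Upper bounds for the right-hand side of the Bessel inequality. In the exceptional
  alternative \<open>a\<close> and \<open>b\<close> cover all edges, and the vertices of \<open>C\<close> are twins.\<close>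

lemma unbalanced_case:
  assumes pos: "\<And>v. v \<in> V \<Longrightarrow> 1 \<le> deg v"
    and max: "\<And>v. v \<in> W \<Longrightarrow> int (deg v) - \<alpha> v \<le> int (deg b) - \<delta>"
    and N: "int m + 3 \<le> int (card V) + int (card {v \<in> V - {a}. of_bool (adj a v) < deg v})"
  defines "X \<equiv> (\<Sum>v\<in>V. (int (deg v) - 1)\<^sup>2)"
    and "T \<equiv> (int (deg a))\<^sup>2 + (int m - int (deg a) + 1)\<^sup>2 + 1 - 2 * int m"
    and "C \<equiv> {v \<in> V. adj a v \<and> adj b v}"
  shows "X \<le> T \<or> adj a b \<and> (\<forall>v\<in>C. deg v = 2) \<and> 2 \<le> card C \<and> X = T + int (card C) - 1"
proof -
  \<comment> \<open>\<open>q\<close> counts the edges at \<open>b\<close> other than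
    \<open>ab\<close>, \<open>j\<close> the vertices besides \<open>a\<close> not adjacent to
    \<open>a\<close>, and \<open>\<rho>\<close> sums \<open>r\<close> over the neighbours of
    \<open>b\<close> in \<open>W\<close>.\<close>
  define q where "q = int (deg b) - \<delta>"
  define j where "j = (1 - \<delta>) + (\<Sum>v\<in>W. 1 - \<alpha> v)"
  define \<rho> where "\<rho> = (\<Sum>v\<in>W. \<beta> v * r v)"
  have mq: "int m = int (deg a) + q + eW" by (simp add: q_def eW_def)
  have T: "T = (int (deg a) - 1)\<^sup>2 + q\<^sup>2 + 2 * q * eW + eW\<^sup>2 + 1"
    unfolding T_def using mq by (simp add: power2_eq_square algebra_simps)
  have u0: "0 \<le> eW" by (rule eW_nonneg)
  have q0: "0 \<le> q" using pos[OF ab(2)] by (simp add: q_def of_bool_def)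
  have j: "int (card V) = 1 + int (deg a) + j"
    unfolding card_V j_def sum_subtractf sum_alpha by simp
  have posW: "1 \<le> \<alpha> v + \<beta> v + r v" if "v \<in> W" for v using pos[of v] that by simp
  show ?thesis
  proof (cases "eW = 0")
    case False
    then have u1: "1 \<le> eW" using u0 by simp
    have \<rho>j: "\<rho> + 1 \<le> j + eW"
      using N card_nonisolated_le j mq unfolding \<rho>_def[symmetric] q_def[symmetric] by linarith
    \<comment> \<open>A non-neighbour of \<open>a\<close> has
      \<open>\<beta> v + r v \<ge> 1\<close>, so lowering this number by one lowers its square by at
      least one. These savings add up to almost \<open>j\<close>.\<close>
    have "(\<alpha> v + \<beta> v + r v - 1)\<^sup>2 \<le> (\<beta> v + r v)\<^sup>2 - (1 - \<alpha> v)" if "v \<in> W" for v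
      using posW[OF that] by (cases "adj a v") (auto simp: power2_eq_square algebra_simps)
    then have "(\<Sum>v\<in>W. (\<alpha> v + \<beta> v + r v - 1)\<^sup>2) \<le> (\<Sum>v\<in>W. (\<beta> v + r v)\<^sup>2 - (1 - \<alpha> v))"
      by (rule sum_mono)
    also have "(\<Sum>v\<in>W. (\<beta> v + r v)\<^sup>2 - (1 - \<alpha> v))
        = (\<Sum>v\<in>W. \<beta> v + 2 * (\<beta> v * r v) + (r v)\<^sup>2 - (1 - \<alpha> v))"
      by (intro sum.cong refl) (auto simp: power2_eq_square algebra_simps of_bool_def)
    also have "\<dots> = q + 2 * \<rho> + (\<Sum>v\<in>W. (r v)\<^sup>2) - (j - (1 - \<delta>))"
      unfolding sum_subtractf[of _ "\<lambda>v. 1 - \<alpha> v"] sum.distrib sum_beta q_def \<rho>_def j_def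
      by (simp only: sum_distrib_left)
    finally have Y: "(\<Sum>v\<in>W. (\<alpha> v + \<beta> v + r v - 1)\<^sup>2)
        \<le> q + 2 * \<rho> + (\<Sum>v\<in>W. (r v)\<^sup>2) - (j - (1 - \<delta>))" .
    have B: "(int (deg b) - 1)\<^sup>2 \<le> q\<^sup>2 - (1 - \<delta>)"
      using pos[OF ab(2)] by (cases "adj a b") (auto simp: q_def power2_eq_square algebra_simps)
    have X: "X \<le> (int (deg a) - 1)\<^sup>2 + q\<^sup>2 + q + 2 * \<rho> + eW\<^sup>2 + eW - j"
      unfolding X_def sum_deg_minus_one_sq_split using Y B sum_r_sq by linarith
    have q_pos: "1 \<le> q"
    proof (rule ccontr)
      assume "\<not> 1 \<le> q"
      then have "r v \<le> 0" if "v \<in> W" for v using max[OF that] q0 by (auto simp: q_def)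
      then have "(\<Sum>v\<in>W. r v) \<le> 0" by (rule sum_nonpos)
      then show False using u1 by (simp only: sum_r)
    qed
    \<comment> \<open>Exactly what \<open>X \<le> T\<close> requires once \<open>j\<close> is
      eliminated by \<open>\<rho>j\<close>. For \<open>q = 1\<close> the choice of \<open>b\<close>
      leaves its neighbours no edge inside \<open>W\<close>; for larger \<open>q\<close> the trivial
      bound \<open>\<rho> \<le> 2 * eW\<close> is enough.\<close>
    have "\<rho> + 2 * eW \<le> q * (2 * eW - 1) + 2"
    proof (cases "q = 1")
      case True
      have "\<beta> v * r v = 0" if "v \<in> W" for v
        using max[OF that] r_nonneg[of v] True by (cases "adj b v") (auto simp: q_def)
      then have "\<rho> = 0" unfolding \<rho>_def by (rule sum.neutral[OF ballI])
      with True show ?thesis by simp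
    next
      case False
      then have "2 * (2 * eW - 1) \<le> q * (2 * eW - 1)" using q_pos u1 by (intro mult_right_mono) auto
      then show ?thesis using sum_beta_r_le unfolding \<rho>_def[symmetric]
        by (simp add: algebra_simps)
    qed
    then have "\<rho> + 3 * eW \<le> 2 * q * eW + eW - q + 2" by (simp add: algebra_simps)
    then have "X \<le> T" using X \<rho>j unfolding T by linarith
    then show ?thesis ..
  next
    case True
    \<comment> \<open>All edges now meet \<open>a\<close> or \<open>b\<close>, so in
      \<open>W\<close> only the common neighbours contribute to \<open>X\<close>, each of them
      1.\<close>
    have r0: "r v = 0" if "v \<in> W" for v
      using sum_r True r_nonneg that sum_nonneg_eq_0_iff[of W r] by simp
    have Y: "(\<alpha> v + \<beta> v + r v - 1)\<^sup>2 = \<alpha> v * \<beta> v" if "v \<in> W" for v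
      using posW[OF that] r0[OF that] by (cases "adj a v"; cases "adj b v") auto
    have X: "X = (int (deg a) - 1)\<^sup>2 + (int (deg b) - 1)\<^sup>2 + (\<Sum>v\<in>W. \<alpha> v * \<beta> v)"
      unfolding X_def sum_deg_minus_one_sq_split by (simp only: Y cong: sum.cong)
    have T': "T = (int (deg a) - 1)\<^sup>2 + q\<^sup>2 + 1" using T True by simp
    show ?thesis
    proof (cases "adj a b")
      case False
      have "(\<Sum>v\<in>W. \<alpha> v * \<beta> v) \<le> (\<Sum>v\<in>W. \<beta> v)" by (intro sum_mono) auto
      then have "(\<Sum>v\<in>W. \<alpha> v * \<beta> v) \<le> q" by (simp only: sum_beta q_def)
      moreover have "(int (deg b) - 1)\<^sup>2 = q\<^sup>2 - 2 * q + 1"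
        using False by (simp add: q_def power2_diff)
      ultimately show ?thesis using X T' q0 by linarith
    next
      case adj: True
      \<comment> \<open>Here \<open>deg b - 1 = q\<close>, so nothing offsets the contribution of
        the common neighbours; \<open>X\<close> exceeds \<open>T\<close> as soon as there are two of
        them.\<close>
      have CW: "C \<subseteq> W" using adj_irrefl unfolding C_def by auto
      have "(\<Sum>v\<in>W. \<alpha> v * \<beta> v) = int (card C)"
      proof -
        have "(\<Sum>v\<in>W. \<alpha> v * \<beta> v) = (\<Sum>v\<in>W. of_bool (v \<in> C))"
          by (intro sum.cong refl) (auto simp: C_def)
        then show ?thesis using CW by (simp add: sum_of_bool_eq Int_absorb1)
      qed
      then have X': "X = T + int (card C) - 1" using X T' adj by (simp add: q_def)
      have "deg v = 2" if "v \<in> C" for v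
        using r0[of v] that CW by (auto simp: C_def)
      then show ?thesis using X' adj by (cases "2 \<le> card C") auto
    qed
  qed
qed

text \<open>The right-hand side is what contradicts Bessel's inequality:
  \<open>(m - 1)\<^sup>2 + 4 * m = (m + 1)\<^sup>2\<close>, and the squares of \<open>l1 - 1\<close>
  and \<open>l2 - 1\<close> add up to more than half of that.\<close>

lemma balanced_case:
  assumes pos: "\<And>v. v \<in> V \<Longrightarrow> 1 \<le> deg v"
    and ba: "deg b \<le> deg a" and max: "\<And>v. v \<in> W \<Longrightarrow> deg v \<le> deg b"
    and half: "2 * deg a \<le> m"
    and N: "int m + 3 \<le> int (card V) + int (card {v \<in> V - {a}. of_bool (adj a v) < deg v})"
  shows "2 * (\<Sum>v\<in>V. (int (deg v) - 1)\<^sup>2) \<le> (int m - 1)\<^sup>2 + 2"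
proof -
  \<comment> \<open>Thus \<open>deg b - 1 = Q\<close> and \<open>deg a - 1 = Q + D\<close>;
    \<open>c\<close> counts the common neighbours, \<open>n0\<close> the vertices of
    \<open>W\<close> adjacent to neither \<open>a\<close> nor \<open>b\<close>.\<close>
  define Q where "Q = int (deg b) - 1"
  define D where "D = int (deg a) - int (deg b)"
  define c where "c = (\<Sum>v\<in>W. \<alpha> v * \<beta> v)"
  define n0 where "n0 = (\<Sum>v\<in>W. (1 - \<alpha> v) * (1 - \<beta> v))"
  define \<rho> where "\<rho> = (\<Sum>v\<in>W. \<alpha> v * \<beta> v * r v)"
  define Y where "Y = (\<Sum>v\<in>W. (\<alpha> v + \<beta> v + r v - 1)\<^sup>2)"
  have Q0: "0 \<le> Q" using pos[OF ab(2)] by (simp add: Q_def)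
  have D0: "0 \<le> D" using ba by (simp add: D_def)
  have Du: "D \<le> eW - \<delta>" using half by (simp add: D_def eW_def)
  have mQ: "int m = 2 * Q + D + 2 - \<delta> + eW" by (simp add: Q_def D_def eW_def)
  have X: "(\<Sum>v\<in>V. (int (deg v) - 1)\<^sup>2) = (Q + D)\<^sup>2 + Q\<^sup>2 + Y"
    unfolding sum_deg_minus_one_sq_split Y_def Q_def D_def by simp
  have posW: "1 \<le> \<alpha> v + \<beta> v + r v" if "v \<in> W" for v using pos[of v] that by simp
  have maxW: "\<alpha> v + \<beta> v + r v - 1 \<le> Q" if "v \<in> W" for v
    using max[OF that] by (simp add: Q_def)
  \<comment> \<open>One or both factors of the square are bounded by \<open>Q\<close>, as the choice
    of \<open>b\<close> permits; a common neighbour keeps the extra \<open>1 + r v\<close>, and a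
    vertex adjacent to neither saves \<open>Q\<close>.\<close>
  have "(\<alpha> v + \<beta> v + r v - 1)\<^sup>2
      \<le> \<alpha> v * \<beta> v + \<alpha> v * \<beta> v * r v + Q * r v - (1 - \<alpha> v) * (1 - \<beta> v) * Q" if "v \<in> W" for v
  proof -
    let ?e = "\<alpha> v + \<beta> v + r v - 1"
    have "?e * ?e \<le> Q * ?e" using posW[OF that] maxW[OF that] by (intro mult_right_mono) auto
    moreover have "r v * ?e \<le> r v * Q"
      using r_nonneg[of v] maxW[OF that] by (intro mult_left_mono) auto
    ultimately show ?thesis
      by (cases "adj a v"; cases "adj b v") (auto simp: power2_eq_square algebra_simps)
  qed
  then have "Y \<le> (\<Sum>v\<in>W. \<alpha> v * \<beta> v + \<alpha> v * \<beta> v * r v + Q * r v - (1 - \<alpha> v) * (1 - \<beta> v) * Q)"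
    unfolding Y_def by (rule sum_mono)
  also have "\<dots> = c + \<rho> + Q * (\<Sum>v\<in>W. r v) - n0 * Q"
    unfolding c_def \<rho>_def n0_def sum_distrib_left[of Q r W] sum_distrib_right sum.distrib
      sum_subtractf[of _ "\<lambda>v. (1 - \<alpha> v) * (1 - \<beta> v) * Q"] ..
  finally have Y1: "Y \<le> c + \<rho> + 2 * Q * eW - n0 * Q" by (simp only: sum_r mult.assoc mult.left_commute)
  have c_le: "c \<le> Q + 1 - \<delta>"
  proof -
    have "c \<le> (\<Sum>v\<in>W. \<beta> v)" unfolding c_def by (intro sum_mono) auto
    then show ?thesis by (simp only: sum_beta Q_def)
  qed
  have n00: "0 \<le> n0" unfolding n0_def by (intro sum_nonneg) auto
  have \<rho>_le: "\<rho> + n0 \<le> 2 * eW"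
  proof -
    have "\<alpha> v * \<beta> v * r v + (1 - \<alpha> v) * (1 - \<beta> v) \<le> r v" if "v \<in> W" for v
      using posW[OF that] r_nonneg[of v] by (cases "adj a v"; cases "adj b v") auto
    then have "(\<Sum>v\<in>W. \<alpha> v * \<beta> v * r v + (1 - \<alpha> v) * (1 - \<beta> v)) \<le> (\<Sum>v\<in>W. r v)"
      by (rule sum_mono)
    then show ?thesis by (simp only: sum.distrib sum_r \<rho>_def n0_def)
  qed
  have u0: "0 \<le> eW" by (rule eW_nonneg)
  show ?thesis
  proof (cases "adj a b")
    case False
    \<comment> \<open>\<open>K\<close> is the remainder in the expansion of
      \<open>(m - 1)\<^sup>2\<close>; it is nonnegative because \<open>2 * deg a \<le> m\<close>
      means \<open>D \<le> eW - \<delta>\<close>.\<close>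
    define K where "K = D * (2 * (1 + eW) - D) + (eW - 1)\<^sup>2"
    have "0 \<le> D * (2 * (1 + eW) - D)" using D0 Du u0 False by (intro mult_nonneg_nonneg) auto
    then have K: "0 \<le> K" unfolding K_def by simp
    have "0 \<le> n0 * Q" using n00 Q0 by simp
    then have Y: "2 * Y \<le> 2 * Q + 2 + 4 * eW + 4 * Q * eW" using Y1 c_le \<rho>_le n00 False by simp
    have "(int m - 1)\<^sup>2 + 2 = 2 * ((Q + D)\<^sup>2 + Q\<^sup>2) + (4 * Q + 4 * Q * eW + K + 4 * eW + 2)"
      unfolding mQ K_def using False by (simp add: power2_eq_square algebra_simps)
    then show ?thesis unfolding X using Q0 K Y by (simp add: distrib_left)
  next
    case True
    have u1: "1 \<le> eW" using Du D0 True by simp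
    define K where "K = D * (2 * eW - D)"
    have "0 \<le> K" unfolding K_def using D0 Du u0 True by (intro mult_nonneg_nonneg) auto
    moreover have "(int m - 1)\<^sup>2 + 2 = 2 * ((Q + D)\<^sup>2 + Q\<^sup>2) + (4 * Q * eW + eW\<^sup>2 + 2 + K)"
      unfolding mQ K_def using True by (simp add: power2_eq_square algebra_simps)
    moreover have "2 * Y \<le> 4 * Q * eW + eW\<^sup>2 + 2"
    proof (cases "n0 = 0")
      case False
      \<comment> \<open>A single vertex adjacent to neither \<open>a\<close> nor \<open>b\<close>
        pays for all common neighbours, since \<open>c \<le> Q\<close>.\<close>
      then have "1 * Q \<le> n0 * Q" using n00 Q0 by (intro mult_right_mono) auto
      moreover have "0 \<le> (eW - 2)\<^sup>2" by simp
      ultimately show ?thesis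
        using Y1 c_le \<rho>_le n00 True False by (simp add: power2_diff)
    next
      case n0: True
      have no: "(1 - \<alpha> v) * (1 - \<beta> v) = 0" if "v \<in> W" for v
        using n0 that sum_nonneg_eq_0_iff[of W "\<lambda>v. (1 - \<alpha> v) * (1 - \<beta> v)"]
        unfolding n0_def by simp
      \<comment> \<open>Now \<open>W\<close> is the union of the two neighbourhoods, so
        inclusion-exclusion determines its size, and the hypothesis \<open>N\<close> becomes a bound
        on \<open>c + \<rho>\<close>.\<close>
      have "int (card W) = (\<Sum>v\<in>W. \<alpha> v + \<beta> v - \<alpha> v * \<beta> v)"
      proof -
        have "(\<Sum>v\<in>W. \<alpha> v + \<beta> v - \<alpha> v * \<beta> v) = (\<Sum>v\<in>W. 1)"
          using no by (intro sum.cong refl) (auto simp: algebra_simps)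
        then show ?thesis by simp
      qed
      then have cW: "int (card W) = 2 * Q + D - c"
        unfolding sum_subtractf sum.distrib sum_alpha sum_beta c_def using True
        by (simp add: Q_def D_def)
      have "\<rho> \<le> (\<Sum>v\<in>W. \<beta> v * r v)"
        unfolding \<rho>_def using r_nonneg by (intro sum_mono mult_right_mono) auto
      then have c\<rho>: "c + \<rho> \<le> Q + eW - 1"
        using N card_nonisolated_le card_V cW mQ True by (simp add: Q_def)
      have "(\<alpha> v + \<beta> v + r v - 1)\<^sup>2 = \<alpha> v * \<beta> v + 2 * (\<alpha> v * \<beta> v * r v) + (r v)\<^sup>2" if "v \<in> W" for v
        using no[OF that]
        by (cases "adj a v"; cases "adj b v") (auto simp: power2_eq_square algebra_simps)
      then have "Y = (\<Sum>v\<in>W. \<alpha> v * \<beta> v + 2 * (\<alpha> v * \<beta> v * r v) + (r v)\<^sup>2)"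
        unfolding Y_def by (rule sum.cong[OF refl])
      also have "\<dots> = c + 2 * \<rho> + (\<Sum>v\<in>W. (r v)\<^sup>2)"
        unfolding sum.distrib c_def \<rho>_def by (simp only: sum_distrib_left)
      finally have Y2: "Y \<le> c + 2 * \<rho> + eW\<^sup>2 + eW" using sum_r_sq by linarith
      \<comment> \<open>Together with \<open>c\<rho>\<close>, the linear bound \<open>Y1\<close>
        suffices when \<open>2 * Q \<le> eW\<^sup>2 - 2 * eW + 4\<close>, and the quadratic bound
        \<open>Y2\<close> with \<open>\<rho> \<le> 2 * eW\<close> does for larger \<open>Q\<close>
        unless \<open>eW = 1\<close>.\<close>
      consider "eW = 1" | "eW = 2" "Q \<le> 2" | "eW = 2" "3 \<le> Q"
        | "3 \<le> eW" "2 * Q \<le> eW\<^sup>2 - 2 * eW + 4" | "3 \<le> eW" "eW\<^sup>2 - 2 * eW + 5 \<le> 2 * Q"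
        using u1 by linarith
      then show ?thesis
      proof cases
        case 1
        \<comment> \<open>A single edge inside \<open>W\<close> forces \<open>r \<le> 1\<close>
          there, whence \<open>\<rho> \<le> c\<close> sharpens \<open>Y2\<close>.\<close>
        have nn: "0 \<le> r w * (r w - 1)" for w
          using r_nonneg[of w] by (cases "r w = 0") auto
        have "(\<Sum>v\<in>W. (r v)\<^sup>2) - (\<Sum>v\<in>W. r v) \<le> 0" using sum_r_sq 1 unfolding sum_r by simp
        then have sum0: "(\<Sum>v\<in>W. r v * (r v - 1)) \<le> 0"
          by (simp add: power2_eq_square right_diff_distrib flip: sum_subtractf)
        have r1: "r v \<le> 1" if "v \<in> W" for v
        proof (rule ccontr)
          assume "\<not> r v \<le> 1"
          then have "2 * 1 \<le> r v * (r v - 1)" by (intro mult_mono) auto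
          moreover have "r v * (r v - 1) \<le> (\<Sum>v\<in>W. r v * (r v - 1))"
            using that nn by (intro member_le_sum) auto
          ultimately show False using sum0 by linarith
        qed
        have "\<alpha> v * \<beta> v * r v \<le> \<alpha> v * \<beta> v" if "v \<in> W" for v
          using r1[OF that] by (cases "adj a v"; cases "adj b v") auto
        then have "\<rho> \<le> c" unfolding \<rho>_def c_def by (rule sum_mono)
        then show ?thesis using Y1 Y2 c\<rho> 1 Q0 n0 by (cases "Q = 0") auto
      next
        case 2
        then show ?thesis using Y1 c\<rho> n0 by auto
      next
        case 3
        then show ?thesis using Y2 c\<rho> \<rho>_le n0 by auto
      next
        case 4
        then show ?thesis using Y1 c\<rho> n0 by simp
      next
        case 5
        have "3 * (2 * eW - 1) \<le> eW * (2 * eW - 1)" using 5 by (intro mult_right_mono) auto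
        then have uu: "7 * eW - 3 \<le> 2 * eW\<^sup>2" by (simp add: power2_eq_square algebra_simps)
        have "(eW\<^sup>2 - 2 * eW + 5) * (2 * eW - 1) \<le> 2 * Q * (2 * eW - 1)"
          using 5 by (intro mult_right_mono) auto
        \<comment> \<open>The difference of the two sides is
          \<open>2 * eW * (eW - 1) * (eW - 2) - 1\<close>.\<close>
        moreover have "eW\<^sup>2 + 8 * eW - 4 \<le> (eW\<^sup>2 - 2 * eW + 5) * (2 * eW - 1)"
        proof -
          have "0 \<le> 2 * eW * ((eW - 1) * (eW - 2)) - 1"
          proof -
            have "2 * 3 * (2 * 1) \<le> 2 * eW * ((eW - 1) * (eW - 2))"
              using 5 by (intro mult_mono) auto
            then show ?thesis by simp
          qed
          then show ?thesis by (simp add: power2_eq_square algebra_simps)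
        qed
        ultimately show ?thesis using Y2 c\<rho> \<rho>_le n0 by (simp add: algebra_simps)
      qed
    qed
    ultimately show ?thesis unfolding X by (simp add: distrib_left)
  qed
qed

end
end

section \<open>The two largest Laplacian eigenvalues of a graph\<close>

lemma finite_argmax:
  fixes g :: "'a \<Rightarrow> 'b :: linorder"
  assumes "finite A" "A \<noteq> {}"
  obtains b where "b \<in> A" "\<And>v. v \<in> A \<Longrightarrow> g v \<le> g b"
proof -
  have "Max (g ` A) \<in> g ` A" using assms by simp
  then obtain b where "b \<in> A" "g b = Max (g ` A)" by auto
  then show thesis using that[of b] assms(1) by simp
qed

text \<open>The squared distance from \<open>f\<close> to its projection onto the span of
  \<open>x\<close>, \<open>y\<close> and the constant vector is nonnegative; normalizing the
  constant vector produces the division by \<open>card V\<close>.\<close>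

lemma bessel_three:
  fixes f x y :: "'a \<Rightarrow> real"
  assumes V: "finite V"
    and x: "(\<Sum>v\<in>V. (x v)\<^sup>2) = 1" "(\<Sum>v\<in>V. x v) = 0"
    and y: "(\<Sum>v\<in>V. (y v)\<^sup>2) = 1" "(\<Sum>v\<in>V. y v) = 0"
    and xy: "(\<Sum>v\<in>V. x v * y v) = 0"
  shows "(\<Sum>v\<in>V. f v * x v)\<^sup>2 + (\<Sum>v\<in>V. f v * y v)\<^sup>2 + (\<Sum>v\<in>V. f v)\<^sup>2 / card V
    \<le> (\<Sum>v\<in>V. (f v)\<^sup>2)"
proof -
  define A where "A = (\<Sum>v\<in>V. f v * x v)"
  define B where "B = (\<Sum>v\<in>V. f v * y v)"
  define F where "F = (\<Sum>v\<in>V. f v)"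
  define c where "c = F / card V"
  have n: "card V \<noteq> 0" using x(1) V by (metis card_0_eq sum.empty zero_neq_one)
  have "0 \<le> (\<Sum>v\<in>V. (f v - A * x v - B * y v - c)\<^sup>2)" by (rule sum_nonneg) simp
  also have "\<dots> = (\<Sum>v\<in>V. (f v)\<^sup>2 + A\<^sup>2 * (x v)\<^sup>2 + B\<^sup>2 * (y v)\<^sup>2 + c\<^sup>2
      - 2 * A * (f v * x v) - 2 * B * (f v * y v) - 2 * c * f v
      + 2 * A * B * (x v * y v) + 2 * A * c * x v + 2 * B * c * y v)"
    by (intro sum.cong refl) (simp add: power2_eq_square algebra_simps)
  also have "\<dots> = (\<Sum>v\<in>V. (f v)\<^sup>2) + A\<^sup>2 + B\<^sup>2 + card V * c\<^sup>2 - 2 * A * A - 2 * B * B - 2 * c * F"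
    by (simp add: sum.distrib sum_subtractf x y xy flip: sum_distrib_left A_def B_def F_def)
  also have "\<dots> = (\<Sum>v\<in>V. (f v)\<^sup>2) - A\<^sup>2 - B\<^sup>2 - F\<^sup>2 / card V"
    using n by (simp add: c_def power2_eq_square)
  finally show ?thesis by (simp add: A_def B_def F_def)
qed

context fin_graph
begin

text \<open>As \<open>z\<close> vanishes at \<open>a\<close>, each edge \<open>av\<close>
  contributes just \<open>(z v)\<^sup>2\<close>.\<close>

lemma qform_delete_vertex:
  assumes a: "a \<in> V" and z: "z a = 0"
  shows "qform z = (\<Sum>v\<in>V. of_bool (adj a v) * (z v)\<^sup>2)
    + fin_graph.qform (V - {a}) (\<lambda>u v. adj u v \<and> u \<in> V - {a} \<and> v \<in> V - {a}) z"
proof -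
  let ?g = "\<lambda>u v. of_bool (adj u v) * (z u - z v)\<^sup>2"
  interpret H: fin_graph "V - {a}" "\<lambda>u v. adj u v \<and> u \<in> V - {a} \<and> v \<in> V - {a}"
    by (rule fin_graph_restrict) auto
  have split: "sum f V = f a + sum f (V - {a})" for f :: "'a \<Rightarrow> real"
    using a by (simp add: sum.remove)
  have "(\<Sum>u\<in>V. \<Sum>v\<in>V. ?g u v)
      = (\<Sum>v\<in>V. ?g a v) + ((\<Sum>u\<in>V - {a}. ?g u a) + (\<Sum>u\<in>V - {a}. \<Sum>v\<in>V - {a}. ?g u v))"
    by (simp add: split sum.distrib)
  moreover have "(\<Sum>v\<in>V. ?g a v) = (\<Sum>v\<in>V. of_bool (adj a v) * (z v)\<^sup>2)"
    using z by simp
  moreover have "(\<Sum>u\<in>V - {a}. ?g u a) = (\<Sum>v\<in>V. of_bool (adj a v) * (z v)\<^sup>2)"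
    using z by (simp add: split adj_commute[of _ a])
  moreover have "(\<Sum>u\<in>V - {a}. \<Sum>v\<in>V - {a}. ?g u v) = 2 * H.qform z"
  proof -
    have "(\<Sum>u\<in>V - {a}. \<Sum>v\<in>V - {a}. ?g u v)
        = (\<Sum>u\<in>V - {a}. \<Sum>v\<in>V - {a}. of_bool (adj u v \<and> u \<in> V - {a} \<and> v \<in> V - {a}) * (z u - z v)\<^sup>2)"
      by (intro sum.cong refl) auto
    then show ?thesis by (simp only: H.qform_def)
  qed
  ultimately show ?thesis by (simp add: qform_def)
qed

text \<open>Some nonzero combination \<open>z\<close> of \<open>x\<close> and \<open>y\<close>
  vanishes at \<open>a\<close>, and its Rayleigh quotient is at least \<open>l2\<close>. The edges
  at \<open>a\<close> contribute at most 1 to this quotient; the rest is the form of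
  \<open>G - a\<close>, bounded by its number of edges plus 1 and by its number of non-isolated
  vertices.\<close>

lemma second_eigenvalue_le:
  assumes m: "(\<Sum>v\<in>V. deg v) = 2 * m" and a: "a \<in> V"
    and x: "\<And>v. v \<in> V \<Longrightarrow> lap x v = l1 * x v" and y: "\<And>v. v \<in> V \<Longrightarrow> lap y v = l2 * y v"
    and xx: "(\<Sum>v\<in>V. (x v)\<^sup>2) = 1" and yy: "(\<Sum>v\<in>V. (y v)\<^sup>2) = 1"
    and xy: "(\<Sum>v\<in>V. x v * y v) = 0" and l: "l2 \<le> l1"
  shows "l2 \<le> real m - real (deg a) + 2"
    and "l2 \<le> 1 + real (card {v \<in> V - {a}. of_bool (adj a v) < deg v})"
proof -
  interpret H: fin_graph "V - {a}" "\<lambda>u v. adj u v \<and> u \<in> V - {a} \<and> v \<in> V - {a}"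
    by (rule fin_graph_restrict) auto
  have degH: "of_bool (adj a v) + H.deg v = deg v" if "v \<in> V - {a}" for v
  proof -
    have "deg v = of_bool (adj v a) + (\<Sum>u\<in>V - {a}. of_bool (adj v u))"
      using a deg_eq_sum[of v, where 'b = nat] by (simp add: sum.remove)
    also have "(\<Sum>u\<in>V - {a}. of_bool (adj v u)) = H.deg v"
      using that by (subst H.deg_eq_sum[of v, where 'b = nat, unfolded of_nat_id]) (auto intro!: sum.cong)
    finally show ?thesis by (simp add: adj_commute)
  qed
  have "deg a + (\<Sum>v\<in>V - {a}. deg v) = 2 * m" using m a by (simp add: sum.remove)
  moreover have "(\<Sum>v\<in>V - {a}. of_bool (adj a v)) = deg a"
    using a deg_eq_sum[of a, where 'b = nat] by (simp add: sum.remove)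
  moreover have "(\<Sum>v\<in>V - {a}. deg v) = (\<Sum>v\<in>V - {a}. of_bool (adj a v) + H.deg v)"
    by (rule sum.cong[OF refl]) (rule degH[symmetric])
  ultimately have eq: "2 * deg a + (\<Sum>v\<in>V - {a}. H.deg v) = 2 * m"
    by (simp add: sum.distrib)
  then have mH: "(\<Sum>v\<in>V - {a}. H.deg v) = 2 * (m - deg a)" and am: "deg a \<le> m" by auto
  obtain s t where st: "s * x a + t * y a = 0" "s\<^sup>2 + t\<^sup>2 \<noteq> 0"
  proof (cases "x a = 0 \<and> y a = 0")
    case True then show thesis using that[of 1 0] by simp
  next
    case False
    then have "(y a)\<^sup>2 + (- x a)\<^sup>2 \<noteq> 0" by (auto simp: sum_power2_eq_zero_iff)
    then show thesis using that[of "y a" "- x a"] by (simp add: mult.commute)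
  qed
  define z where "z = (\<lambda>v. s * x v + t * y v)"
  have za: "z a = 0" using st by (simp add: z_def)
  have zz: "(\<Sum>v\<in>V. (z v)\<^sup>2) = s\<^sup>2 + t\<^sup>2"
  proof -
    have "(\<Sum>v\<in>V. (z v)\<^sup>2) = (\<Sum>v\<in>V. s\<^sup>2 * (x v)\<^sup>2 + t\<^sup>2 * (y v)\<^sup>2 + 2 * s * t * (x v * y v))"
      unfolding z_def by (intro sum.cong refl) (simp add: power2_eq_square algebra_simps)
    then show ?thesis by (simp add: sum.distrib xx yy xy flip: sum_distrib_left)
  qed
  have "qform z = (\<Sum>v\<in>V. z v * lap z v)" by (simp add: sum_mult_lap)
  also have "\<dots> = (\<Sum>v\<in>V. l1 * s\<^sup>2 * (x v)\<^sup>2 + l2 * t\<^sup>2 * (y v)\<^sup>2 + (l1 + l2) * s * t * (x v * y v))"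
    unfolding z_def lap_linear
    by (intro sum.cong refl) (simp add: x y power2_eq_square algebra_simps)
  also have "\<dots> = l1 * s\<^sup>2 + l2 * t\<^sup>2"
    by (simp add: sum.distrib xx yy xy flip: sum_distrib_left)
  finally have qz: "qform z = l1 * s\<^sup>2 + l2 * t\<^sup>2" .
  have "l2 * s\<^sup>2 \<le> l1 * s\<^sup>2" using l by (intro mult_right_mono) auto
  then have low: "l2 * (s\<^sup>2 + t\<^sup>2) \<le> qform z" by (simp add: qz distrib_left)
  have "(\<Sum>v\<in>V. of_bool (adj a v) * (z v)\<^sup>2) \<le> s\<^sup>2 + t\<^sup>2"
    unfolding zz[symmetric] by (intro sum_mono) (auto simp: of_bool_def)
  then have up: "qform z \<le> (s\<^sup>2 + t\<^sup>2) + H.qform z"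
    using qform_delete_vertex[of a z, OF a za] by linarith
  have zH: "(\<Sum>v\<in>V - {a}. (z v)\<^sup>2) = s\<^sup>2 + t\<^sup>2"
    using zz za a by (simp add: sum.remove)
  have st0: "0 < s\<^sup>2 + t\<^sup>2" using st(2) by (simp add: less_le sum_power2_ge_zero)
  have *: "l2 \<le> 1 + K" if "H.qform z \<le> K * (s\<^sup>2 + t\<^sup>2)" for K
  proof -
    have "l2 * (s\<^sup>2 + t\<^sup>2) \<le> (1 + K) * (s\<^sup>2 + t\<^sup>2)"
      using low up that by (simp only: distrib_right mult_1)
    then show ?thesis using st0 by (simp add: mult_le_cancel_right)
  qed
  show "l2 \<le> real m - real (deg a) + 2"
    using *[of "real (m - deg a) + 1"] H.qform_le_edges[OF mH, of z] am unfolding zH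
    by (simp add: of_nat_diff)
  have "0 < H.deg v \<longleftrightarrow> of_bool (adj a v) < deg v" if "v \<in> V - {a}" for v
    using degH[OF that] by linarith
  then have eqH: "{v \<in> V - {a}. 0 < H.deg v} = {v \<in> V - {a}. of_bool (adj a v) < deg v}"
    by blast
  show "l2 \<le> 1 + real (card {v \<in> V - {a}. of_bool (adj a v) < deg v})"
    by (rule *[OF H.qform_le_vertices[of z, unfolded zH eqH]])
qed

lemma sum_two_eigenvalues_le:
  assumes pos: "\<And>v. v \<in> V \<Longrightarrow> 1 \<le> deg v" and m: "(\<Sum>v\<in>V. deg v) = 2 * m"
    and x: "\<And>v. v \<in> V \<Longrightarrow> lap x v = l1 * x v" and y: "\<And>v. v \<in> V \<Longrightarrow> lap y v = l2 * y v"
    and xx: "(\<Sum>v\<in>V. (x v)\<^sup>2) = 1" and yy: "(\<Sum>v\<in>V. (y v)\<^sup>2) = 1"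
    and xy: "(\<Sum>v\<in>V. x v * y v) = 0" and l: "l2 \<le> l1"
  shows "l1 + l2 \<le> real m + 3"
proof (rule ccontr)
  assume "\<not> l1 + l2 \<le> real m + 3"
  then have S: "real m + 3 < l1 + l2" by simp
  have q1: "qform x = l1"
  proof -
    have "qform x = (\<Sum>v\<in>V. l1 * (x v)\<^sup>2)"
      unfolding sum_mult_lap[symmetric] by (intro sum.cong refl) (simp add: x power2_eq_square)
    then show ?thesis by (simp add: xx flip: sum_distrib_left)
  qed
  have l1m: "l1 \<le> real m + 1" using qform_le_edges[OF m, of x] by (simp add: q1 xx)
  \<comment> \<open>Both eigenvalues exceed 2: they are nonzero, and \<open>l - 2\<close> may later
    be a denominator.\<close>
  then have l2: "2 < l2" using S by simp
  have "{v \<in> V. 0 < deg v} = V" using pos by force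
  then have l1n: "l1 \<le> real (card V)" using qform_le_vertices[of x] by (simp add: q1 xx)
  note second = second_eigenvalue_le[OF m _ x y xx yy xy l]
  \<comment> \<open>A strict inequality between integers gains one.\<close>
  have N: "int m + 3 \<le> int (card V) + int (card {v \<in> V - {a}. of_bool (adj a v) < deg v})"
    if "a \<in> V" for a
  proof -
    have "real m + 2 < real (card V) + real (card {v \<in> V - {a}. of_bool (adj a v) < deg v})"
      using second(2)[OF that] l1n S by linarith
    then show ?thesis by linarith
  qed
  have x0: "(\<Sum>v\<in>V. x v) = 0" and y0: "(\<Sum>v\<in>V. y v) = 0"
  proof -
    have "l1 * (\<Sum>v\<in>V. x v) = 0" "l2 * (\<Sum>v\<in>V. y v) = 0"
      using sum_lap[of x] sum_lap[of y] x y by (simp_all add: sum_distrib_left)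
    then show "(\<Sum>v\<in>V. x v) = 0" "(\<Sum>v\<in>V. y v) = 0" using l l2 by auto
  qed
  note bessel = bessel_three[OF finite_V xx x0 yy y0 xy]
  define n where "n = real (card V)"
  have V0: "V \<noteq> {}" using xx by auto
  then have n0: "0 < n" by (simp add: n_def card_gt_0_iff)
  \<comment> \<open>The squared norm of the projection of row \<open>v\<close> of
    \<open>L - I\<close> onto the three orthonormal vectors; the row sum \<open>-1\<close> gives the
    term \<open>1 / n\<close>.\<close>
  define R where "R v = (l1 - 1)\<^sup>2 * (x v)\<^sup>2 + (l2 - 1)\<^sup>2 * (y v)\<^sup>2 + 1 / n" for v
  have sumR: "(\<Sum>v\<in>V. R v) = (l1 - 1)\<^sup>2 + (l2 - 1)\<^sup>2 + 1"
    using n0 V0 by (simp add: R_def sum.distrib xx yy n_def flip: sum_distrib_left)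
  \<comment> \<open>Only the three inner products matter, so \<open>f\<close> need not be the row
    itself; the twins below exploit this.\<close>
  have row: "R v \<le> (\<Sum>u\<in>V. (f u)\<^sup>2)"
    if "(\<Sum>u\<in>V. f u * x u) = (l1 - 1) * x v" "(\<Sum>u\<in>V. f u * y u) = (l2 - 1) * y v"
      "(\<Sum>u\<in>V. f u) = -1" for f v
    using bessel[of f] that by (simp add: R_def n_def power_mult_distrib)
  have row1: "R v \<le> (real (deg v) - 1)\<^sup>2 + real (deg v)" if v: "v \<in> V" for v
  proof -
    define f where "f u = (real (deg v) - 1) * of_bool (u = v) - of_bool (adj v u)" for u
    have 1: "(\<Sum>u\<in>V. of_bool (u = v) * g u) = g v" for g :: "'a \<Rightarrow> real"
    proof -
      have "(\<Sum>u\<in>V. of_bool (u = v) * g u) = (\<Sum>u\<in>V. if u = v then g u else 0)"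
        by (intro sum.cong) auto
      then show ?thesis using v by simp
    qed
    have fg: "(\<Sum>u\<in>V. f u * g u) = lap g v - g v" for g
    proof -
      have "(\<Sum>u\<in>V. f u * g u)
          = (real (deg v) - 1) * (\<Sum>u\<in>V. of_bool (u = v) * g u) - (\<Sum>u\<in>V. of_bool (adj v u) * g u)"
        by (simp add: f_def sum_distrib_left sum_subtractf algebra_simps)
      then show ?thesis unfolding 1 lap_eq by (simp add: algebra_simps)
    qed
    have "(\<Sum>u\<in>V. f u) = -1" using fg[of "\<lambda>_. 1"] by (simp add: lap_def)
    moreover have "(\<Sum>u\<in>V. f u * x u) = (l1 - 1) * x v" "(\<Sum>u\<in>V. f u * y u) = (l2 - 1) * y v"
      using fg[of x] fg[of y] x[OF v] y[OF v] by (simp_all add: left_diff_distrib)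
    ultimately have "R v \<le> (\<Sum>u\<in>V. (f u)\<^sup>2)" by (intro row)
    also have "\<dots> = (\<Sum>u\<in>V. of_bool (u = v) * (real (deg v) - 1)\<^sup>2 + of_bool (adj v u))"
      by (intro sum.cong refl) (auto simp: f_def)
    finally show ?thesis by (simp add: sum.distrib 1 deg_eq_sum)
  qed
  define X where "X = (\<Sum>v\<in>V. (int (deg v) - 1)\<^sup>2)"
  have X: "real_of_int X = (\<Sum>v\<in>V. (real (deg v) - 1)\<^sup>2)" by (simp add: X_def)
  have degm: "(\<Sum>v\<in>V. real (deg v)) = 2 * real m" using m by (metis of_nat_mult of_nat_numeral of_nat_sum)
  have star: "(l1 - 1)\<^sup>2 + (l2 - 1)\<^sup>2 + 1 \<le> real_of_int X + 2 * real m"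
    using sum_mono[of V R "\<lambda>v. (real (deg v) - 1)\<^sup>2 + real (deg v)"] row1
    by (simp add: sumR sum.distrib X degm)
  obtain a where a: "a \<in> V" and amax: "\<And>v. v \<in> V \<Longrightarrow> deg v \<le> deg a"
    using finite_argmax[OF finite_V V0] by blast
  have Va: "V - {a} \<noteq> {}"
  proof
    assume "V - {a} = {}"
    then have "{u \<in> V. adj a u} = {}" using adj_irrefl[of a] by auto
    then show False using pos[OF a] unfolding deg_def by (metis card.empty not_one_le_zero)
  qed
  have finVa: "finite (V - {a})" by simp
  show False
  proof (cases "2 * deg a \<le> m")
    case True
    obtain b where b: "b \<in> V - {a}" "\<And>v. v \<in> V - {a} \<Longrightarrow> int (deg v) \<le> int (deg b)"
      using finite_argmax[OF finVa Va, of "\<lambda>v. int (deg v)"] by blast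
    have "2 * X \<le> (int m - 1)\<^sup>2 + 2"
      unfolding X_def using b amax[of b] True N[OF a] pos
      by (intro balanced_case[OF a _ _ m]) auto
    then have "2 * real_of_int X \<le> (real m - 1)\<^sup>2 + 2"
      by (metis (mono_tags) of_int_1 of_int_add of_int_diff of_int_le_iff of_int_mult of_int_numeral of_int_of_nat_eq of_int_power)
    moreover have "(real m + 1)\<^sup>2 < (l1 + l2 - 2)\<^sup>2"
      using S by (intro power_strict_mono) auto
    moreover have "(l1 + l2 - 2)\<^sup>2 \<le> 2 * ((l1 - 1)\<^sup>2 + (l2 - 1)\<^sup>2)"
      using zero_le_power2[of "l1 - l2"] by (simp add: power2_eq_square algebra_simps)
    ultimately show False using star by (simp add: power2_eq_square algebra_simps)
  next
    case False
    define d where "d = real (deg a)"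
    define h where "h = real m - d"
    have dh: "h + 1 \<le> d" using False unfolding h_def d_def by linarith
    have h0: "0 < h + 1"
    proof -
      obtain c where "adj a c" using pos[OF a] unfolding deg_def by (metis (mono_tags, lifting) card.empty ex_in_conv mem_Collect_eq not_one_le_zero)
      then show ?thesis using deg_add_le[OF m, of a c] pos[of c] adj_in_V[of c a] adj_sym[of a c] unfolding h_def d_def by simp
    qed
    have "l2 \<le> h + 2" using second(1)[OF a] by (simp add: h_def d_def)
    then have l1d: "d < l1 - 1" using S by (simp add: h_def)
    \<comment> \<open>The pair \<open>l1 - 1\<close>, \<open>l2 - 1\<close> has a larger sum than
      \<open>d\<close>, \<open>h + 1\<close> and is more spread out, since
      \<open>l1 - 1 > d \<ge> h + 1\<close>; hence its sum of squares is larger.\<close>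
    have big: "d\<^sup>2 + (h + 1)\<^sup>2 < (l1 - 1)\<^sup>2 + (l2 - 1)\<^sup>2"
    proof -
      have "0 < 2 * (h + 1) * (l1 + l2 - 2 - d - (h + 1))"
        using h0 S by (intro mult_pos_pos) (auto simp: h_def)
      moreover have "0 \<le> 2 * (d - (h + 1)) * (l1 - 1 - d)"
        using dh l1d by (intro mult_nonneg_nonneg) auto
      moreover have "0 \<le> (l1 - 1 - d)\<^sup>2" "0 \<le> (l2 - 1 - (h + 1))\<^sup>2" by simp_all
      ultimately show ?thesis by (simp add: power2_eq_square algebra_simps)
    qed
    \<comment> \<open>Unlike in the balanced case, \<open>b\<close> has maximal degree in
      \<open>G - a\<close>.\<close>
    obtain b where b: "b \<in> V - {a}"
      "\<And>v. v \<in> V - {a} \<Longrightarrow> int (deg v) - of_bool (adj a v) \<le> int (deg b) - of_bool (adj a b)"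
      using finite_argmax[OF finVa Va, of "\<lambda>v. int (deg v) - of_bool (adj a v)"] by blast
    define T where "T = (int (deg a))\<^sup>2 + (int m - int (deg a) + 1)\<^sup>2 + 1 - 2 * int m"
    have T: "real_of_int T = d\<^sup>2 + (h + 1)\<^sup>2 + 1 - 2 * real m"
      by (simp add: T_def d_def h_def)
    define C where "C = {v \<in> V. adj a v \<and> adj b v}"
    have "X \<le> T \<or> adj a b \<and> (\<forall>v\<in>C. deg v = 2) \<and> 2 \<le> card C \<and> X = T + int (card C) - 1"
      unfolding X_def T_def C_def using b N[OF a] pos
      by (intro unbalanced_case[OF a _ _ m]) auto
    then show False
    proof
      assume "X \<le> T"
      then have "real_of_int X \<le> real_of_int T" by simp
      then show False using star big T by linarith
    next
      assume "adj a b \<and> (\<forall>v\<in>C. deg v = 2) \<and> 2 \<le> card C \<and> X = T + int (card C) - 1"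
      then have C2: "\<And>v. v \<in> C \<Longrightarrow> deg v = 2" and cC: "2 \<le> card C"
        and XT: "X = T + int (card C) - 1" by auto
      define c where "c = real (card C)"
      have c0: "0 < c" using cC by (simp add: c_def)
      have CV: "C \<subseteq> V" "a \<notin> C" "b \<notin> C" and bV: "b \<in> V" "b \<noteq> a"
        using b(1) by (auto simp: C_def)
      have nb: "of_bool (adj v u) = (of_bool (u = a) + of_bool (u = b) :: real)" if v: "v \<in> C" for u v
      proof -
        have "{a, b} \<subseteq> {u \<in> V. adj v u}" using v a bV adj_sym by (auto simp: C_def)
        then have "{u \<in> V. adj v u} = {a, b}"
          using C2[OF v] bV(2) unfolding deg_def by (intro card_seteq[symmetric]) auto
        then show ?thesis using bV adj_in_V adj_sym by fastforce
      qed
      have one: "(\<Sum>u\<in>V. of_bool (u = w) * g u) = g w" if "w \<in> V" for g :: "'a \<Rightarrow> real" and w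
      proof -
        have "(\<Sum>u\<in>V. of_bool (u = w) * g u) = (\<Sum>u\<in>V. if u = w then g u else 0)"
          by (intro sum.cong) auto
        then show ?thesis using that by simp
      qed
      have lapC: "lap g v = 2 * g v - g a - g b" if "v \<in> C" for g v
        unfolding lap_eq C2[OF that] nb[OF that] using one[OF a] one[OF bV(1)]
        by (simp add: distrib_right sum.distrib)
      have "g v = (\<Sum>u\<in>C. g u) / c" if g: "\<And>v. v \<in> V \<Longrightarrow> lap g v = l * g v" "2 < l" and v: "v \<in> C" for g l v
      proof -
        \<comment> \<open>The eigenvalue equation at a twin determines the value there from
          \<open>g a\<close> and \<open>g b\<close> alone, so \<open>g\<close> is constant on
          \<open>C\<close>.\<close>
        have "g u = - (g a + g b) / (l - 2)" if "u \<in> C" for u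
          using lapC[OF that, of g] g(1)[of u] g(2) that CV(1) by (auto simp: field_simps)
        then have "(\<Sum>u\<in>C. g u) = c * (- (g a + g b) / (l - 2))" "g v = - (g a + g b) / (l - 2)"
          using v by (simp_all add: c_def)
        then show ?thesis using c0 by simp
      qed
      then have mean: "(\<Sum>u\<in>C. x u) / c = x v" "(\<Sum>u\<in>C. y u) / c = y v" if "v \<in> C" for v
        using x y l l2 that by (metis less_le_trans)+
      have row2: "R v \<le> 2 + 1 / c" if v: "v \<in> C" for v
      proof -
        \<comment> \<open>The average of the rows of \<open>L - I\<close> over \<open>C\<close>: its
          squared norm is \<open>2 + 1 / c\<close>, where a single row has 3.\<close>
        define f where "f u = of_bool (u \<in> C) / c - of_bool (u = a) - of_bool (u = b)" for u
        have inC: "(\<Sum>u\<in>V. of_bool (u \<in> C) * g u) = (\<Sum>u\<in>C. g u)" for g :: "'a \<Rightarrow> real"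
          using CV(1) by (simp add: sum_of_bool_mult_eq Int_absorb1)
        have fg: "(\<Sum>u\<in>V. f u * g u) = (\<Sum>u\<in>C. g u) / c - g a - g b" for g
        proof -
          have "(\<Sum>u\<in>V. f u * g u) = (\<Sum>u\<in>V. of_bool (u \<in> C) * g u) / c
              - (\<Sum>u\<in>V. of_bool (u = a) * g u) - (\<Sum>u\<in>V. of_bool (u = b) * g u)"
            by (simp add: f_def left_diff_distrib sum_subtractf sum_divide_distrib)
          then show ?thesis by (simp only: inC one[OF a] one[OF bV(1)])
        qed
        have fx: "(\<Sum>u\<in>V. f u * x u) = (l1 - 1) * x v"
          using fg[of x] mean(1)[OF v] lapC[OF v, of x] x[of v] v CV(1) by (auto simp: algebra_simps)
        have fy: "(\<Sum>u\<in>V. f u * y u) = (l2 - 1) * y v"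
          using fg[of y] mean(2)[OF v] lapC[OF v, of y] y[of v] v CV(1) by (auto simp: algebra_simps)
        have f1: "(\<Sum>u\<in>V. f u) = -1" using fg[of "\<lambda>_. 1"] c0 by (simp add: c_def)
        have "(\<Sum>u\<in>V. (f u)\<^sup>2) = (\<Sum>u\<in>V. f u * f u)" by (simp add: power2_eq_square)
        also have "\<dots> = (\<Sum>u\<in>C. f u) / c - f a - f b" by (rule fg)
        also have "(\<Sum>u\<in>C. f u) = (\<Sum>u\<in>C. 1 / c)"
          using CV by (intro sum.cong refl) (auto simp: f_def)
        also have "\<dots> = 1" using c0 by (simp add: c_def)
        also have "1 / c - f a - f b = 2 + 1 / c" using CV bV(2) by (simp add: f_def)
        finally show ?thesis using row[OF fx fy f1] by simp
      qed
      \<comment> \<open>Each of the \<open>c\<close> twins saves \<open>1 - 1 / c\<close>, in total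
        \<open>c - 1\<close>, which is the excess of \<open>X\<close> over \<open>T\<close>.\<close>
      have "(\<Sum>v\<in>V. R v) \<le> (\<Sum>v\<in>V. (real (deg v) - 1)\<^sup>2 + real (deg v) - of_bool (v \<in> C) * (1 - 1 / c))"
      proof (rule sum_mono)
        fix v assume v: "v \<in> V"
        show "R v \<le> (real (deg v) - 1)\<^sup>2 + real (deg v) - of_bool (v \<in> C) * (1 - 1 / c)"
          using row1[OF v] row2[of v] C2[of v] by (cases "v \<in> C") auto
      qed
      also have "\<dots> = real_of_int X + 2 * real m - c * (1 - 1 / c)"
        using CV(1) by (simp add: sum.distrib sum_subtractf X degm sum_of_bool_mult_eq Int_absorb1 c_def)
      also have "\<dots> = real_of_int X + 2 * real m - (c - 1)" using c0 by (simp add: field_simps)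
      finally show False using big T XT sumR by (simp add: c_def)
    qed
  qed
qed

end

section \<open>Laplacians of families of sets\<close>

text \<open>The Gram matrix of the columns has form at most \<open>(k - 1)\<close> times the sum of
  squares plus the square of the sum of absolute values. With \<open>z\<close> the adjoint applied
  to \<open>x\<close> and \<open>g\<close> the matrix applied to \<open>z\<close>, Cauchy-Schwarz
  for \<open>x\<close> and \<open>g\<close> carries this over to \<open>x\<close>.\<close>

lemma sum_squares_adjoint_le:
  fixes M :: "'r \<Rightarrow> 'c \<Rightarrow> real"
  assumes R: "finite R" and C: "finite C"
    and diag: "\<And>c. c \<in> C \<Longrightarrow> (\<Sum>r\<in>R. M r c * M r c) \<le> k"
    and off: "\<And>c d. c \<in> C \<Longrightarrow> d \<in> C \<Longrightarrow> c \<noteq> d \<Longrightarrow> \<bar>\<Sum>r\<in>R. M r c * M r d\<bar> \<le> 1"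
    and k: "1 \<le> k"
  shows "(\<Sum>c\<in>C. (\<Sum>r\<in>R. M r c * x r)\<^sup>2) \<le> (k - 1 + card C) * (\<Sum>r\<in>R. (x r)\<^sup>2)"
proof -
  define z where "z c = (\<Sum>r\<in>R. M r c * x r)" for c
  define g where "g r = (\<Sum>c\<in>C. M r c * z c)" for r
  define Q where "Q = (\<Sum>c\<in>C. (z c)\<^sup>2)"
  have Q0: "0 \<le> Q" unfolding Q_def by (simp add: sum_nonneg)
  have "(\<Sum>r\<in>R. x r * g r) = (\<Sum>r\<in>R. \<Sum>c\<in>C. M r c * x r * z c)"
    by (simp add: g_def sum_distrib_left mult_ac)
  also have "\<dots> = (\<Sum>c\<in>C. \<Sum>r\<in>R. M r c * x r * z c)" by (rule sum.swap)
  also have "\<dots> = Q" by (simp add: Q_def z_def power2_eq_square flip: sum_distrib_right)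
  finally have Qg: "Q = (\<Sum>r\<in>R. x r * g r)" by simp
  have "(\<Sum>r\<in>R. (g r)\<^sup>2) = (\<Sum>r\<in>R. \<Sum>c\<in>C. \<Sum>d\<in>C. M r c * M r d * (z c * z d))"
    by (simp add: g_def power2_eq_square sum_product mult_ac)
  also have "\<dots> = (\<Sum>c\<in>C. \<Sum>r\<in>R. \<Sum>d\<in>C. M r c * M r d * (z c * z d))" by (rule sum.swap)
  also have "\<dots> = (\<Sum>c\<in>C. \<Sum>d\<in>C. (\<Sum>r\<in>R. M r c * M r d) * (z c * z d))"
    by (subst sum.swap[of _ C R]) (simp only: sum_distrib_right)
  also have "\<dots> \<le> (\<Sum>c\<in>C. \<Sum>d\<in>C. \<bar>z c\<bar> * \<bar>z d\<bar> + (k - 1) * ((z c)\<^sup>2 * of_bool (c = d)))"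
  proof (intro sum_mono)
    fix c d assume cd: "c \<in> C" "d \<in> C"
    show "(\<Sum>r\<in>R. M r c * M r d) * (z c * z d) \<le> \<bar>z c\<bar> * \<bar>z d\<bar> + (k - 1) * ((z c)\<^sup>2 * of_bool (c = d))"
    proof (cases "c = d")
      case True
      have "(\<Sum>r\<in>R. M r c * M r c) * (z c)\<^sup>2 \<le> k * (z c)\<^sup>2"
        using diag[OF cd(1)] by (intro mult_right_mono) auto
      then show ?thesis using True by (simp add: power2_eq_square algebra_simps flip: abs_mult)
    next
      case False
      have "(\<Sum>r\<in>R. M r c * M r d) * (z c * z d) \<le> \<bar>\<Sum>r\<in>R. M r c * M r d\<bar> * \<bar>z c * z d\<bar>"
        by (metis abs_ge_self abs_mult)
      also have "\<dots> \<le> 1 * \<bar>z c * z d\<bar>" using off[OF cd False] by (intro mult_right_mono) auto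
      finally show ?thesis using False by (simp add: abs_mult)
    qed
  qed
  also have "\<dots> = (\<Sum>c\<in>C. \<bar>z c\<bar>)\<^sup>2 + (k - 1) * Q"
  proof -
    have "(\<Sum>d\<in>C. (z c)\<^sup>2 * of_bool (c = d)) = (z c)\<^sup>2" if "c \<in> C" for c
    proof -
      have "(\<Sum>d\<in>C. (z c)\<^sup>2 * of_bool (c = d)) = (\<Sum>d\<in>C. if c = d then (z c)\<^sup>2 else 0)"
        by (intro sum.cong) auto
      then show ?thesis using C that by simp
    qed
    then have "(\<Sum>c\<in>C. \<Sum>d\<in>C. (z c)\<^sup>2 * of_bool (c = d)) = Q"
      unfolding Q_def by (rule sum.cong[OF refl])
    then show ?thesis
      by (simp only: sum.distrib power2_eq_square[of "sum _ _"] sum_product flip: sum_distrib_left)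
  qed
  also have "(\<Sum>c\<in>C. \<bar>z c\<bar>)\<^sup>2 \<le> real (card C) * Q"
    using Cauchy_Schwarz_ineq_sum[of "\<lambda>_. 1" "\<lambda>c. \<bar>z c\<bar>" C] by (simp add: Q_def)
  finally have G: "(\<Sum>r\<in>R. (g r)\<^sup>2) \<le> (k - 1 + card C) * Q" by (simp add: algebra_simps)
  have "Q\<^sup>2 \<le> (\<Sum>r\<in>R. (x r)\<^sup>2) * (\<Sum>r\<in>R. (g r)\<^sup>2)"
    unfolding Qg by (rule Cauchy_Schwarz_ineq_sum)
  also have "\<dots> \<le> (\<Sum>r\<in>R. (x r)\<^sup>2) * ((k - 1 + card C) * Q)"
    using G by (intro mult_left_mono) (auto simp: sum_nonneg)
  finally have "Q * Q \<le> ((k - 1 + card C) * (\<Sum>r\<in>R. (x r)\<^sup>2)) * Q"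
    by (simp add: power2_eq_square mult_ac)
  then have "Q \<le> (k - 1 + card C) * (\<Sum>r\<in>R. (x r)\<^sup>2)"
    using Q0 k by (cases "Q = 0") (auto simp: sum_nonneg mult_le_cancel_right)
  then show ?thesis by (simp add: Q_def z_def)
qed

section \<open>Columns of the boundary matrix\<close>

lemma incidence_cases:
  assumes "finite F"
  obtains "incidence G F = 0" | v where "v \<in> F" "G = F - {v}" "\<bar>incidence G F\<bar> = 1"
proof (cases "\<exists>j < card F. G = F - {sorted_list_of_set F ! j}")
  case True
  then obtain j where j: "j < card F" "G = F - {sorted_list_of_set F ! j}" by auto
  have "sorted_list_of_set F ! j \<in> F"
    using j(1) assms by (metis length_sorted_list_of_set nth_mem set_sorted_list_of_set)
  then show thesis using that(2) j incidence_eq[OF assms j] by (simp add: power_abs)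
next
  case False
  then show thesis using that(1) unfolding incidence_def by auto
qed

lemma incidence_column_norm_le:
  assumes R: "finite R" and F: "finite F"
  shows "(\<Sum>G\<in>R. incidence G F * incidence G F) \<le> card F"
proof -
  let ?I = "(\<lambda>v. F - {v}) ` F"
  have "(\<Sum>G\<in>R. incidence G F * incidence G F) \<le> (\<Sum>G\<in>R. of_bool (G \<in> ?I))"
  proof (rule sum_mono)
    fix G
    show "incidence G F * incidence G F \<le> of_bool (G \<in> ?I)"
    proof (cases rule: incidence_cases[OF F, of G])
      case (2 v)
      then have "incidence G F * incidence G F = 1" by (metis abs_mult_self_eq mult_1)
      then show ?thesis using 2 by simp
    qed simp
  qed
  also have "\<dots> = card (R \<inter> ?I)" using R by (simp add: sum_of_bool_eq)
  also have "\<dots> \<le> card ?I" using F by (simp add: card_mono)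
  also have "\<dots> \<le> card F" using F by (simp add: card_image_le)
  finally show ?thesis by simp
qed

text \<open>Two distinct facets of equal size can share only one face of codimension one, namely
  \<open>F \<inter> F'\<close>.\<close>

lemma incidence_columns_inner_le:
  assumes R: "finite R" and F: "finite F" "finite F'" "card F = card F'" "F \<noteq> F'"
  shows "\<bar>\<Sum>G\<in>R. incidence G F * incidence G F'\<bar> \<le> 1"
proof -
  have zero: "incidence G F * incidence G F' = 0" if "G \<noteq> F \<inter> F'" for G
  proof (rule ccontr)
    assume "incidence G F * incidence G F' \<noteq> 0"
    then obtain v w where "v \<in> F" "G = F - {v}" "w \<in> F'" "G = F' - {w}"
      using incidence_cases[OF F(1), of G] incidence_cases[OF F(2), of G] by (metis mult_eq_0_iff)
    moreover have "\<not> F \<subseteq> F'" using F by (metis card_subset_eq)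
    ultimately show False using that by blast
  qed
  have one: "\<bar>incidence G F\<bar> \<le> 1" "\<bar>incidence G F'\<bar> \<le> 1" for G
    using incidence_cases[OF F(1), of G] incidence_cases[OF F(2), of G]
    by (metis abs_zero order_refl zero_le_one)+
  have "(\<Sum>G\<in>R. incidence G F * incidence G F')
      = (\<Sum>G\<in>R \<inter> {F \<inter> F'}. incidence G F * incidence G F')"
    using R zero by (intro sum.mono_neutral_right) auto
  also have "\<bar>\<dots>\<bar> \<le> 1"
  proof (cases "F \<inter> F' \<in> R")
    case True
    then show ?thesis using one by (simp add: abs_mult mult_le_one)
  qed simp
  finally show ?thesis .
qed

section \<open>From indexed vectors to functions on faces\<close>

lemma bij_betw_nth_set: "distinct xs \<Longrightarrow> bij_betw ((!) xs) {..<length xs} (set xs)"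
  by (rule bij_betw_nth) auto

lemma distinct_row_faces: "distinct (row_faces n k)"
  by (simp add: row_faces_def distinct_all_subsets)

lemma distinct_column_faces: "distinct (column_faces n S)"
  by (simp add: column_faces_def distinct_all_subsets)

lemma laplacian_carrier: "laplacian n k S \<in> carrier_mat (length (row_faces n k)) (length (row_faces n k))"
  unfolding laplacian_def boundary_matrix_def by auto

lemma laplacian_symmetric: "transpose_mat (laplacian n k S) = laplacian n k S"
  unfolding laplacian_def
  by (subst transpose_mult[of _ "length (row_faces n k)" "length (column_faces n S)"])
    (auto simp: boundary_matrix_def)

lemma sum_row_faces:
  "(\<Sum>i<length (row_faces n k). f (row_faces n k ! i)) = (\<Sum>G\<in>set (row_faces n k). f G)"
  using sum.reindex_bij_betw[OF bij_betw_nth_set[OF distinct_row_faces]] .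

lemma sum_column_faces:
  assumes "k_family n k S"
  shows "(\<Sum>i<length (column_faces n S). f (column_faces n S ! i)) = (\<Sum>F\<in>facets S. f F)"
  using sum.reindex_bij_betw[OF bij_betw_nth_set[OF distinct_column_faces]] set_column_faces[OF assms]
  by metis

lemma laplacian_eigenvector_eq:
  assumes K: "k_family n k S"
    and v: "v \<in> carrier_vec (length (row_faces n k))" "laplacian n k S *\<^sub>v v = l \<cdot>\<^sub>v v"
    and x: "\<And>i. i < length (row_faces n k) \<Longrightarrow> v $ i = x (row_faces n k ! i)"
    and G: "G \<in> set (row_faces n k)"
  shows "l * x G = (\<Sum>F\<in>facets S. incidence G F * (\<Sum>H\<in>set (row_faces n k). incidence H F * x H))"
proof -
  let ?r = "row_faces n k" and ?c = "column_faces n S"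
  let ?B = "boundary_matrix n k S"
  have B: "?B \<in> carrier_mat (length ?r) (length ?c)" by (simp add: boundary_matrix_def)
  obtain i where i: "i < length ?r" "G = ?r ! i" using G by (metis in_set_conv_nth)
  have T: "(transpose_mat ?B *\<^sub>v v) $ j = (\<Sum>H\<in>set ?r. incidence H (?c ! j) * x H)"
    if j: "j < length ?c" for j
  proof -
    have "(transpose_mat ?B *\<^sub>v v) $ j = (\<Sum>i<length ?r. incidence (?r ! i) (?c ! j) * x (?r ! i))"
      using j v(1) x by (simp add: boundary_matrix_def scalar_prod_def lessThan_atLeast0)
    then show ?thesis
      using sum_row_faces[of "\<lambda>H. incidence H (?c ! j) * x H" n k] by simp
  qed
  have "l * x G = (laplacian n k S *\<^sub>v v) $ i" using i v x by simp
  also have "laplacian n k S *\<^sub>v v = ?B *\<^sub>v (transpose_mat ?B *\<^sub>v v)"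
    unfolding laplacian_def using B v(1) by (intro assoc_mult_mat_vec) auto
  also have "\<dots> $ i = (\<Sum>j<length ?c. incidence G (?c ! j) * (transpose_mat ?B *\<^sub>v v) $ j)"
    using i B by (simp add: boundary_matrix_def scalar_prod_def lessThan_atLeast0)
  also have "\<dots> = (\<Sum>j<length ?c. incidence G (?c ! j) * (\<Sum>H\<in>set ?r. incidence H (?c ! j) * x H))"
    using T by simp
  finally show ?thesis
    using sum_column_faces[OF K, of "\<lambda>F. incidence G F * (\<Sum>H\<in>set ?r. incidence H F * x H)"] by simp
qed

lemma vec_as_face_function:
  fixes v :: "real vec"
  obtains x where "\<And>i. i < length (row_faces n k) \<Longrightarrow> v $ i = x (row_faces n k ! i)"
proof
  fix i assume "i < length (row_faces n k)"
  then show "v $ i = (\<lambda>G. v $ the_inv_into {..<length (row_faces n k)} ((!) (row_faces n k)) G) (row_faces n k ! i)"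
    using bij_betw_nth_set[OF distinct_row_faces] by (simp add: the_inv_into_f_f bij_betw_def)
qed

lemma scalar_prod_face_functions:
  fixes v w :: "real vec"
  assumes "w \<in> carrier_vec (length (row_faces n k))"
    and "\<And>i. i < length (row_faces n k) \<Longrightarrow> v $ i = x (row_faces n k ! i)"
    and "\<And>i. i < length (row_faces n k) \<Longrightarrow> w $ i = y (row_faces n k ! i)"
  shows "v \<bullet> w = (\<Sum>G\<in>set (row_faces n k). x G * y G)"
  using assms sum_row_faces[of "\<lambda>G. x G * y G" n k]
  by (simp add: scalar_prod_def lessThan_atLeast0)

lemma k_family_facetD:
  assumes "k_family n k S" "F \<in> facets S"
  shows "F \<subseteq> {1..n}" "card F = k" "finite F"
  using assms k_family_iff_generated[of n k S] finite_subset[of F "{1..n}"] by auto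

lemma finite_facets: "k_family n k S \<Longrightarrow> finite (facets S)"
  using set_column_faces by (metis List.finite_set)

text \<open>Pairing the eigenvalue equation with \<open>x\<close> turns \<open>l\<close> times its
  squared norm into the squared norm of the transposed boundary matrix applied to
  \<open>x\<close>.\<close>

lemma laplacian_eigenvalue_le:
  assumes K: "k_family n k S" and k: "1 \<le> k" and ev: "eigenvalue (laplacian n k S) l"
  shows "l \<le> real k - 1 + real (card (facets S))"
proof -
  let ?R = "set (row_faces n k)"
  obtain v where v: "v \<in> carrier_vec (length (row_faces n k))" "v \<noteq> 0\<^sub>v (length (row_faces n k))"
    "laplacian n k S *\<^sub>v v = l \<cdot>\<^sub>v v"
    using ev laplacian_carrier[of n k S] unfolding eigenvalue_def eigenvector_def by auto
  obtain x where x: "\<And>i. i < length (row_faces n k) \<Longrightarrow> v $ i = x (row_faces n k ! i)"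
    using vec_as_face_function[of n k v] by blast
  define s where "s = (\<Sum>G\<in>?R. (x G)\<^sup>2)"
  have "s > 0"
  proof -
    have "v \<bullet> v = s"
      using scalar_prod_face_functions[OF v(1) x x] by (simp add: s_def power2_eq_square)
    moreover have "v \<bullet> v > 0" using conjugate_square_greater_0_vec[OF v(1)] v(2) by simp
    ultimately show ?thesis by simp
  qed
  have "l * s = (\<Sum>G\<in>?R. x G * (l * x G))"
    by (simp add: s_def sum_distrib_left power2_eq_square mult_ac)
  also have "\<dots> = (\<Sum>G\<in>?R. \<Sum>F\<in>facets S. incidence G F * x G * (\<Sum>H\<in>?R. incidence H F * x H))"
    using laplacian_eigenvector_eq[OF K v(1,3) x] by (simp add: sum_distrib_left mult_ac)
  also have "\<dots> = (\<Sum>F\<in>facets S. (\<Sum>H\<in>?R. incidence H F * x H)\<^sup>2)"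
    by (subst sum.swap) (simp add: power2_eq_square flip: sum_distrib_right)
  also have "\<dots> \<le> (real k - 1 + card (facets S)) * s"
    unfolding s_def
  proof (rule sum_squares_adjoint_le)
    show "(\<Sum>G\<in>?R. incidence G F * incidence G F) \<le> real k" if "F \<in> facets S" for F
      using incidence_column_norm_le[of ?R F] k_family_facetD[OF K that] by simp
    show "\<bar>\<Sum>G\<in>?R. incidence G F * incidence G F'\<bar> \<le> 1"
      if "F \<in> facets S" "F' \<in> facets S" "F \<noteq> F'" for F F'
      using incidence_columns_inner_le[of ?R F F'] k_family_facetD[OF K that(1)]
        k_family_facetD[OF K that(2)] that(3) by simp
  qed (use finite_facets[OF K] k in auto)
  finally show ?thesis using \<open>s > 0\<close> by (simp add: mult_le_cancel_right)
qed


section \<open>The case of graphs\<close>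

lemma incidence_pair:
  assumes "u \<noteq> v"
  shows "incidence {v} {u, v} * incidence {v} {u, v} = 1"
    and "incidence {v} {u, v} * incidence {u} {u, v} = -1"
    and "w \<noteq> u \<Longrightarrow> w \<noteq> v \<Longrightarrow> incidence {w} {u, v} = 0"
proof -
  \<comment> \<open>Which endpoint gets the minus sign depends on the order, but the signs are
    always opposite, so only products of entries are stated in general.\<close>
  have *: "incidence {b} {a, b} = 1" "incidence {a} {a, b} = -1" if "a < b" for a b
  proof -
    have "sorted_list_of_set {a, b} = [a, b]" using that by (simp add: sorted_list_of_set_nonempty min_def)
    moreover have "{a, b} - {a} = {b}" "{a, b} - {b} = {a}" using that by auto
    ultimately show "incidence {b} {a, b} = 1" "incidence {a} {a, b} = -1"
      using incidence_eq[of "{a, b}" 0 "{b}"] incidence_eq[of "{a, b}" 1 "{a}"] that by auto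
  qed
  show "incidence {v} {u, v} * incidence {v} {u, v} = 1"
    and "incidence {v} {u, v} * incidence {u} {u, v} = -1"
    using *[of u v] *[of v u] assms by (cases "u < v"; simp add: insert_commute)+
  show "incidence {w} {u, v} = 0" if "w \<noteq> u" "w \<noteq> v"
    by (rule incidence_cases[of "{u, v}" "{w}"]) (use that assms in auto)
qed

text \<open>The rows also include elements of \<open>{1..n}\<close> lying in no facet. Eigenvectors
  for positive eigenvalues vanish there, so they live on the graph spanned by the facets, which has
  no isolated vertex; it remains to normalize them.\<close>

lemma sum_two_laplacian_eigenvalues_graph:
  fixes v w :: "real vec"
  assumes K: "k_family n 2 S"
    and v: "v \<in> carrier_vec (length (row_faces n 2))" "v \<noteq> 0\<^sub>v (length (row_faces n 2))"
      "laplacian n 2 S *\<^sub>v v = l1 \<cdot>\<^sub>v v"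
    and w: "w \<in> carrier_vec (length (row_faces n 2))" "w \<noteq> 0\<^sub>v (length (row_faces n 2))"
      "laplacian n 2 S *\<^sub>v w = l2 \<cdot>\<^sub>v w"
    and vw: "v \<bullet> w = 0" and l: "0 < l2" "l2 \<le> l1"
  shows "l1 + l2 \<le> real (card (facets S)) + 3"
proof -
  define V where "V = \<Union> (facets S)"
  define adj where "adj u v \<longleftrightarrow> u \<noteq> v \<and> {u, v} \<in> facets S" for u v
  note facet = k_family_facetD[OF K]
  have Vn: "V \<subseteq> {1..n}" using facet(1) by (auto simp: V_def)
  interpret fin_graph V adj
    using finite_subset[OF Vn] by unfold_locales (auto simp: adj_def V_def insert_commute)
  have pair: "\<exists>u. adj a u \<and> F = {u, a}" if F: "F \<in> facets S" "a \<in> F" for F a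
  proof -
    obtain u where "F = {a, u}" "a \<noteq> u"
      using facet(2)[OF F(1)] F(2) by (auto simp: card_2_iff doubleton_eq_iff)
    then show ?thesis using F(1) by (auto simp: adj_def insert_commute)
  qed
  have bij: "bij_betw (\<lambda>u. {u, a}) {u \<in> V. adj a u} {F \<in> facets S. a \<in> F}" for a
    unfolding bij_betw_def
  proof
    show "inj_on (\<lambda>u. {u, a}) {u \<in> V. adj a u}" by (auto simp: inj_on_def doubleton_eq_iff)
    show "(\<lambda>u. {u, a}) ` {u \<in> V. adj a u} = {F \<in> facets S. a \<in> F}"
    proof (intro equalityI subsetI)
      fix F assume "F \<in> {F \<in> facets S. a \<in> F}"
      then obtain u where "adj a u" "F = {u, a}" using pair by blast
      then show "F \<in> (\<lambda>u. {u, a}) ` {u \<in> V. adj a u}" using adj_in_V adj_sym by blast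
    qed (auto simp: adj_def insert_commute)
  qed
  have deg_facets: "deg a = card {F \<in> facets S. a \<in> F}" for a
    unfolding deg_def using bij_betw_same_card[OF bij] .
  have pos: "1 \<le> deg a" if "a \<in> V" for a
  proof -
    have "{F \<in> facets S. a \<in> F} \<noteq> {}" using that by (auto simp: V_def)
    then show ?thesis using finite_facets[OF K] by (simp add: deg_facets Suc_le_eq card_gt_0_iff)
  qed
  have m: "(\<Sum>a\<in>V. deg a) = 2 * card (facets S)"
  proof -
    have "(\<Sum>a\<in>V. deg a) = (\<Sum>a\<in>V. \<Sum>F\<in>facets S. of_bool (a \<in> F))"
      using finite_facets[OF K] by (simp add: deg_facets sum_of_bool_eq Int_def)
    also have "\<dots> = (\<Sum>F\<in>facets S. \<Sum>a\<in>V. of_bool (a \<in> F))" by (rule sum.swap)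
    also have "\<dots> = (\<Sum>F\<in>facets S. 2)"
    proof (rule sum.cong[OF refl])
      fix F assume F: "F \<in> facets S"
      then have "V \<inter> F = F" by (auto simp: V_def)
      then show "(\<Sum>a\<in>V. of_bool (a \<in> F)) = (2 :: nat)" using facet(2)[OF F] by (simp add: sum_of_bool_eq)
    qed
    finally show ?thesis by simp
  qed
  have rows: "set (row_faces n 2) = (\<lambda>a. {a}) ` {1..n}"
    by (auto simp: set_row_faces card_1_singleton_iff)
  have sum_rows: "(\<Sum>G\<in>set (row_faces n 2). f G) = (\<Sum>a\<in>{1..n}. f {a})" for f :: "nat set \<Rightarrow> real"
    unfolding rows by (subst sum.reindex) auto
  have eigen: "lap (\<lambda>a. x {a}) a = c * x {a}"
    if z: "z \<in> carrier_vec (length (row_faces n 2))" "laplacian n 2 S *\<^sub>v z = c \<cdot>\<^sub>v z"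
      and x: "\<And>i. i < length (row_faces n 2) \<Longrightarrow> z $ i = x (row_faces n 2 ! i)"
      and a: "a \<in> {1..n}" for z c x a
  proof -
    let ?f = "\<lambda>F. incidence {a} F * (\<Sum>b\<in>{1..n}. incidence {b} F * x {b})"
    have "{a} \<in> set (row_faces n 2)" unfolding rows using a by auto
    then have "c * x {a} = (\<Sum>F\<in>facets S. ?f F)"
      using laplacian_eigenvector_eq[OF K z x, of "{a}"] by (simp only: sum_rows)
    also have "\<dots> = (\<Sum>F\<in>{F \<in> facets S. a \<in> F}. ?f F)"
    proof (rule sum.mono_neutral_right)
      show "\<forall>F\<in>facets S - {F \<in> facets S. a \<in> F}. ?f F = 0"
      proof
        fix F assume F: "F \<in> facets S - {F \<in> facets S. a \<in> F}"
        have "incidence {a} F = 0"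
          by (rule incidence_cases[of F "{a}"]) (use F facet(3) in auto)
        then show "?f F = 0" by simp
      qed
    qed (auto simp: finite_facets[OF K])
    also have "\<dots> = (\<Sum>u\<in>{u \<in> V. adj a u}. ?f {u, a})"
      using sum.reindex_bij_betw[OF bij, of ?f] by simp
    also have "\<dots> = (\<Sum>u\<in>{u \<in> V. adj a u}. x {a} - x {u})"
    proof (rule sum.cong[OF refl])
      fix u assume "u \<in> {u \<in> V. adj a u}"
      then have u: "u \<noteq> a" "u \<in> {1..n}" using Vn by (auto simp: adj_def)
      have "(\<Sum>b\<in>{1..n}. incidence {b} {u, a} * x {b})
          = (\<Sum>b\<in>{u, a}. incidence {b} {u, a} * x {b})"
        using u a incidence_pair(3)[OF u(1)] by (intro sum.mono_neutral_right) auto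
      then have "?f {u, a} = (incidence {a} {u, a} * incidence {u} {u, a}) * x {u}
          + (incidence {a} {u, a} * incidence {a} {u, a}) * x {a}"
        using u(1) by (simp add: algebra_simps)
      then show "?f {u, a} = x {a} - x {u}" by (simp only: incidence_pair[OF u(1)])
    qed
    also have "\<dots> = lap (\<lambda>a. x {a}) a"
      unfolding lap_def by (simp add: sum_of_bool_mult_eq Int_def)
    finally show ?thesis by simp
  qed
  obtain x where x: "\<And>i. i < length (row_faces n 2) \<Longrightarrow> v $ i = x (row_faces n 2 ! i)"
    using vec_as_face_function[of n 2 v] by blast
  obtain y where y: "\<And>i. i < length (row_faces n 2) \<Longrightarrow> w $ i = y (row_faces n 2 ! i)"
    using vec_as_face_function[of n 2 w] by blast
  have outside: "f a = 0" if "lap f a = c * f a" "0 < c" "a \<notin> V" for f c a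
  proof -
    have "lap f a = 0" unfolding lap_def using adj_in_V that(3) by (intro sum.neutral) auto
    then show ?thesis using that by simp
  qed
  have x0: "x {a} = 0" and y0: "y {a} = 0" if "a \<in> {1..n} - V" for a
    using outside[of "\<lambda>a. x {a}" a l1] outside[of "\<lambda>a. y {a}" a l2] that l
      eigen[OF v(1,3) x, of a] eigen[OF w(1,3) y, of a] by auto
  have onV: "(\<Sum>G\<in>set (row_faces n 2). f G * g G) = (\<Sum>a\<in>V. f {a} * g {a})"
    if "\<And>a. a \<in> {1..n} - V \<Longrightarrow> f {a} = 0" for f g :: "nat set \<Rightarrow> real"
    unfolding sum_rows using Vn that by (intro sum.mono_neutral_right) auto
  define s where "s = (\<Sum>a\<in>V. x {a} * x {a})"
  define t where "t = (\<Sum>a\<in>V. y {a} * y {a})"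
  have s: "0 < s"
    using conjugate_square_greater_0_vec[OF v(1)] v(2) scalar_prod_face_functions[OF v(1) x x] onV[of x x] x0
    by (simp add: s_def)
  have t: "0 < t"
    using conjugate_square_greater_0_vec[OF w(1)] w(2) scalar_prod_face_functions[OF w(1) y y] onV[of y y] y0
    by (simp add: t_def)
  have xy: "(\<Sum>a\<in>V. x {a} * y {a}) = 0"
    using vw scalar_prod_face_functions[OF w(1) x y] onV[of x y] x0 by simp
  let ?x = "\<lambda>a. x {a} / sqrt s" and ?y = "\<lambda>a. y {a} / sqrt t"
  have scale: "lap (\<lambda>a. f a / r) a = lap f a / r" for f r a
    unfolding lap_def by (simp add: sum_divide_distrib flip: diff_divide_distrib)
  show ?thesis
  proof (rule sum_two_eigenvalues_le[OF pos m, of ?x l1 ?y l2])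
    show "lap ?x a = l1 * ?x a" "lap ?y a = l2 * ?y a" if "a \<in> V" for a
      using eigen[OF v(1,3) x, of a] eigen[OF w(1,3) y, of a] that Vn by (auto simp: scale)
    show "(\<Sum>a\<in>V. (?x a)\<^sup>2) = 1"
      using s by (simp add: power_divide power2_eq_square[of "x _"] s_def[symmetric] flip: sum_divide_distrib)
    show "(\<Sum>a\<in>V. (?y a)\<^sup>2) = 1"
      using t by (simp add: power_divide power2_eq_square[of "y _"] t_def[symmetric] flip: sum_divide_distrib)
    show "(\<Sum>a\<in>V. ?x a * ?y a) = 0"
      using xy by (simp flip: sum_divide_distrib)
  qed (use l in auto)
qed

section \<open>The bound for all \<open>k\<close>\<close>

theorem theorem34:
  fixes n k :: nat and S :: "nat set set"
  assumes "k \<ge> 2" and "k_family n k S"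
  shows "laplacian_eigenvalue n k S 1 + laplacian_eigenvalue n k S 2
           \<le> (real k - 1) * real (card (facets S)) + real ((k + 1) choose k)
       \<and> (real k - 1) * real (card (facets S)) + real ((k + 1) choose k)
           = (real k - 1) * real (card (facets S)) + real k + 1"
proof -
  let ?A = "laplacian n k S" and ?ls = "laplacian_spectrum n k S"
  define f where "f = real (card (facets S))"
  note A = laplacian_carrier[of n k S]
  have p0: "char_poly ?A \<noteq> 0" using degree_monic_char_poly[OF A] by auto
  have ms: "mset ?ls = proots (char_poly ?A)" by (simp add: laplacian_spectrum_def)
  have choose: "real ((k + 1) choose k) = real k + 1" by simp
  have "facets S \<noteq> {}" using assms(2) k_family_iff_generated by blast
  then have f1: "1 \<le> f"
    using finite_facets[OF assms(2)] by (simp add: f_def Suc_le_eq card_gt_0_iff)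
  \<comment> \<open>The bound on a single eigenvalue settles the cases where the second one is
    nonpositive or takes its default value 0.\<close>
  have kf: "real k - 1 + f \<le> (real k - 1) * f + real k + 1"
  proof -
    have "1 * f \<le> (real k - 1) * f" using assms(1) f1 by (intro mult_right_mono) auto
    then show ?thesis by simp
  qed
  have le: "l \<le> real k - 1 + f" if "l \<in> set ?ls" for l
  proof -
    have "l \<in># proots (char_poly ?A)" using that ms by (metis set_mset_mset)
    then have "eigenvalue ?A l" using p0 unfolding eigenvalue_root_char_poly[OF A] by simp
    then show ?thesis using laplacian_eigenvalue_le[OF assms(2)] assms(1) by (simp add: f_def)
  qed
  have "laplacian_eigenvalue n k S 1 + laplacian_eigenvalue n k S 2 \<le> (real k - 1) * f + real k + 1"
  proof (cases "2 \<le> length ?ls")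
    case False
    have "laplacian_eigenvalue n k S 1 \<le> real k - 1 + f"
      using le[OF nth_mem, of 0] f1 assms(1)
      by (cases "?ls = []") (auto simp: laplacian_eigenvalue_def)
    then show ?thesis using False kf by (simp add: laplacian_eigenvalue_def)
  next
    case True
    then obtain l1 l2 ls where ls: "?ls = l1 # l2 # ls"
      by (metis One_nat_def Suc_1 Suc_le_length_iff)
    have ev: "laplacian_eigenvalue n k S 1 = l1" "laplacian_eigenvalue n k S 2 = l2"
      using ls by (simp_all add: laplacian_eigenvalue_def)
    have "sorted (rev ?ls)" by (simp add: laplacian_spectrum_def)
    then have l21: "l2 \<le> l1" using ls by (simp add: sorted_append)
    have le12: "l1 \<le> real k - 1 + f" "l2 \<le> real k - 1 + f" using le ls by auto
    show ?thesis
    proof (cases "k = 2 \<and> 0 < l2")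
      case False
      then consider "l2 \<le> 0" | "3 \<le> k" using assms(1) by linarith
      then show ?thesis
      proof cases
        case 1
        then show ?thesis using le12 kf ev by simp
      next
        case 2
        \<comment> \<open>Twice the bound \<open>k - 1 + f\<close> is within the claim exactly when
          \<open>k - 3 \<le> (k - 3) * f\<close>.\<close>
        have "(real k - 3) * 1 \<le> (real k - 3) * f" using f1 2 by (intro mult_left_mono) auto
        then show ?thesis using le12 ev by (simp add: algebra_simps)
      qed
    next
      case True
      \<comment> \<open>Roots are removed one at a time from the multiset, so the product of both
        factors divides even if \<open>l1 = l2\<close>.\<close>
      have pr: "proots (char_poly ?A) = add_mset l1 (add_mset l2 (mset ls))"
        using ms ls by simp
      then have "l1 \<in># proots (char_poly ?A)" by simp
      then have "poly (char_poly ?A) l1 = 0" using p0 by simp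
      then obtain g where g: "char_poly ?A = [:- l1, 1:] * g" by (metis dvdE poly_eq_0_iff_dvd)
      then have g0: "g \<noteq> 0" using p0 by auto
      have "proots (char_poly ?A) = proots [:- l1, 1:] + proots g"
        unfolding g using g0 by (intro proots_mult) auto
      then have "proots g = add_mset l2 (mset ls)" using pr by simp
      then have "l2 \<in># proots g" by simp
      then have "[:- l2, 1:] dvd g" using g0 by (simp add: poly_eq_0_iff_dvd)
      then have "[:- l1, 1:] * [:- l2, 1:] dvd char_poly ?A" unfolding g by (rule mult_dvd_mono[OF dvd_refl])
      from symmetric_two_orthogonal_eigenvectors[OF A laplacian_symmetric this]
      obtain v w :: "real vec" where vw: "v \<in> carrier_vec (length (row_faces n k))" "w \<in> carrier_vec (length (row_faces n k))"
        "v \<noteq> 0\<^sub>v (length (row_faces n k))" "w \<noteq> 0\<^sub>v (length (row_faces n k))"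
        "?A *\<^sub>v v = l1 \<cdot>\<^sub>v v" "?A *\<^sub>v w = l2 \<cdot>\<^sub>v w" "v \<bullet> w = 0" by blast
      have k2: "k = 2" using True by simp
      have "l1 + l2 \<le> f + 3"
        unfolding f_def using vw assms(2) True l21 unfolding k2
        by (intro sum_two_laplacian_eigenvalues_graph) auto
      then show ?thesis using ev k2 by simp
    qed
  qed
  then show ?thesis unfolding choose f_def by simp
qed

end
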